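(* Assume that $\alpha_1=1$ and $q_1(t)>0$ for all $t\in[0,T]$, and that $v,q_i\in C[0,T]$ for all $i$. Let $\lambda\ge0$ and $w_0\in\mathbb R$. Then the initial-value problem $$\sum_{i=1}^\ell q_i(t)D_t^{\alpha_i}w(t)+\lambda w(t)=v(t)\quad\text{for }0<t\le T,\qquad w(0)=w_0,$$ has a solution $w\in C^1[0,T]$, and this solution is unique.
   Context: $T>0$; $\ell$ is a positive integer; $0<\alpha_\ell<\dots<\alpha_2<\alpha_1\le1$ are constants; the $q_i$ satisfy $q_i(t)\ge0$ for each $i$ and all $t\in[0,T]$. $D_t^1y:=y'$, and for $0<\alpha_i<1$ the Caputo derivative is $$D_t^{\alpha_i}y(t)=\frac1{\Gamma(1-\alpha_i)}\int_0^t(t-s)^{-\alpha_i}y'(s)\,ds,$$ or, for less smooth $y$, its reformulation (obtained by integration by parts) $$\Gamma(1-\alpha_i)D_t^{\alpha_i}y(t)=t^{-\alpha_i}[y(t)-y(0)]+\int_0^t\alpha_i(t-s)^{-\alpha_i-1}[y(t)-y(s)]\,ds.$$ "Solution" means a function $w\in C[0,T]$ with $w\in W^{1,\infty}(\epsilon,t)$ for all $0<\epsilon<t\le T$, whose derivative $w'$ is left-continuous on $(0,T]$ (possibly with finitely many jump discontinuities), satisfying the equation for all $0<t\le T$ and $w(0)=w_0$. *)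

theory Defs
  imports "HOL-Analysis.Analysis"
begin

text \<open>
  One-dimensional Sobolev spaces. The test functions are \<open>C\<^sup>1\<close> with compact support in
  the open interval, as is usual in one dimension (e.g. Brezis, Chapter 8).
\<close>

definition test_function :: "real \<Rightarrow> real \<Rightarrow> (real \<Rightarrow> real) \<Rightarrow> bool" where
  "test_function a b \<phi> \<longleftrightarrow>
     \<phi> C1_differentiable_on UNIV \<and>
     (\<exists>c d. a < c \<and> d < b \<and> (\<forall>x. x \<notin> {c..d} \<longrightarrow> \<phi> x = 0))"

definition locally_integrable :: "real \<Rightarrow> real \<Rightarrow> (real \<Rightarrow> real) \<Rightarrow> bool" where
  "locally_integrable a b u \<longleftrightarrow> (\<forall>c d. a < c \<and> d < b \<longrightarrow> set_integrable lborel {c..d} u)"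

definition weak_derivative :: "real \<Rightarrow> real \<Rightarrow> (real \<Rightarrow> real) \<Rightarrow> (real \<Rightarrow> real) \<Rightarrow> bool" where
  "weak_derivative a b u g \<longleftrightarrow>
     locally_integrable a b u \<and> locally_integrable a b g \<and>
     (\<forall>\<phi>. test_function a b \<phi> \<longrightarrow>
        (LBINT x:{a<..<b}. u x * deriv \<phi> x) = - (LBINT x:{a<..<b}. g x * \<phi> x))"

definition Linf :: "real \<Rightarrow> real \<Rightarrow> (real \<Rightarrow> real) set" where
  "Linf a b = {u. set_borel_measurable lborel {a<..<b} u \<and>
                  (\<exists>M. AE x in lborel. x \<in> {a<..<b} \<longrightarrow> \<bar>u x\<bar> \<le> M)}"

definition W1inf :: "real \<Rightarrow> real \<Rightarrow> (real \<Rightarrow> real) set" where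
  "W1inf a b = {u. u \<in> Linf a b \<and> (\<exists>g \<in> Linf a b. weak_derivative a b u g)}"

text \<open>
  \<open>C\<^sup>1[a,b]\<close>, with one-sided derivatives at the end points (unlike \<open>C1_differentiable_on\<close>,
  which refers to values outside the interval).
\<close>

definition C1_on_interval :: "real \<Rightarrow> real \<Rightarrow> (real \<Rightarrow> real) set" where
  "C1_on_interval a b =
     {w. \<exists>w'. continuous_on {a..b} w' \<and>
              (\<forall>t\<in>{a..b}. (w has_real_derivative w' t) (at t within {a..b}))}"

text \<open>
  Fractional derivatives of \<open>y\<close> at \<open>t\<close>. The argument \<open>dy\<close> is the chosen pointwise representative
  of the derivative \<open>y'\<close>; it matters because \<open>y'\<close> may jump.
\<close>

definition caputo_classical ::
  "real \<Rightarrow> (real \<Rightarrow> real) \<Rightarrow> real \<Rightarrow> real" where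
  "caputo_classical \<alpha> dy t =
     1 / Gamma (1 - \<alpha>) * (LBINT s:{0<..<t}. (t - s) powr (- \<alpha>) * dy s)"

definition caputo_reformulated ::
  "real \<Rightarrow> (real \<Rightarrow> real) \<Rightarrow> real \<Rightarrow> real" where
  "caputo_reformulated \<alpha> y t =
     1 / Gamma (1 - \<alpha>) *
       (t powr (- \<alpha>) * (y t - y 0)
        + (LBINT s:{0<..<t}. \<alpha> * (t - s) powr (- \<alpha> - 1) * (y t - y s)))"

text \<open>
  The reformulation is used precisely for those \<open>y\<close> that are not smooth enough for the
  classical integral to exist.
\<close>

definition frac_deriv ::
  "real \<Rightarrow> (real \<Rightarrow> real) \<Rightarrow> (real \<Rightarrow> real) \<Rightarrow> real \<Rightarrow> real" where
  "frac_deriv \<alpha> y dy t =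
     (if \<alpha> = 1 then dy t
      else if set_integrable lborel {0<..<t} (\<lambda>s. (t - s) powr (- \<alpha>) * dy s)
      then caputo_classical \<alpha> dy t
      else caputo_reformulated \<alpha> y t)"

text \<open>
  Solutions on \<open>[0,T]\<close>; the values of \<open>w\<close> outside this interval are irrelevant. The
  representative \<open>dw\<close> of \<open>w'\<close> is left-continuous on \<open>(0,T]\<close>, hence uniquely determined there
  by \<open>w\<close>; its finitely many discontinuities are jumps, i.e. its right limits exist.
\<close>

definition left_continuous_derivative ::
  "real \<Rightarrow> (real \<Rightarrow> real) \<Rightarrow> (real \<Rightarrow> real) \<Rightarrow> bool" where
  "left_continuous_derivative T w dw \<longleftrightarrow>
     (\<forall>\<epsilon> t. 0 < \<epsilon> \<and> \<epsilon> < t \<and> t \<le> T \<longrightarrow> weak_derivative \<epsilon> t w dw) \<and>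
     (\<forall>t\<in>{0<..T}. continuous (at_left t) dw) \<and>
     finite {t\<in>{0<..<T}. \<not> isCont dw t} \<and>
     (\<forall>t\<in>{0<..<T}. \<exists>r. (dw \<longlongrightarrow> r) (at_right t))"

definition is_solution ::
  "real \<Rightarrow> nat \<Rightarrow> (nat \<Rightarrow> real) \<Rightarrow> (nat \<Rightarrow> real \<Rightarrow> real) \<Rightarrow> real \<Rightarrow> (real \<Rightarrow> real) \<Rightarrow> real
     \<Rightarrow> (real \<Rightarrow> real) \<Rightarrow> bool" where
  "is_solution T l \<alpha> q lam v w0 w \<longleftrightarrow>
     continuous_on {0..T} w \<and>
     (\<forall>\<epsilon> t. 0 < \<epsilon> \<and> \<epsilon> < t \<and> t \<le> T \<longrightarrow> w \<in> W1inf \<epsilon> t) \<and>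
     (\<exists>dw. left_continuous_derivative T w dw \<and>
           (\<forall>t\<in>{0<..T}. (\<Sum>i=1..l. q i t * frac_deriv (\<alpha> i) w dw t) + lam * w t = v t)) \<and>
     w 0 = w0"

end

theory Submission
  imports Defs
begin

text \<open>
  Existence. The unknown is \<open>g = w'\<close>. Since \<open>w = w0 + \<integral> g\<close> and every Caputo derivative of order
  below 1 is the convolution of \<open>g\<close> with a weakly singular kernel, division by \<open>q 1 > 0\<close> turns the
  problem into a linear Volterra equation of the second kind with integrable kernels and continuous
  data. Multiplying the unknown by \<open>exp (- n t)\<close> with \<open>n\<close> large makes the right-hand side a
  contraction, so a continuous \<open>g\<close> exists (\<open>volterra_convolution_exists\<close>) and \<open>w\<close> is \<open>C\<^sup>1\<close>
  (\<open>C1_solution_exists\<close>).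

  Uniqueness. This is a maximum principle for solutions with little regularity. The weak derivative
  is first brought back to ordinary calculus: testing with smoothed indicators shows that \<open>w\<close> is
  the integral of \<open>dw\<close> away from 0 (\<open>weak_derivative_ftc\<close>), hence \<open>dw t\<close> is the left derivative of
  \<open>w\<close> at every \<open>t > 0\<close>, and the two-sided one except at the jumps. Integration by parts then shows
  that the classical Caputo derivative, where it exists, equals its reformulation
  (\<open>caputo_classical_eq_reformulated\<close>). The reformulation is monotone at a point where the
  difference of two functions is largest so far. If two solutions \<open>w\<close> and \<open>u\<close> had \<open>w - u - m t\<close>
  positive somewhere for some \<open>m > 0\<close>, then at a maximum every term of the equation for \<open>w\<close> would
  be at least that for \<open>u\<close>, and the first order term strictly larger, although both equations have
  the same right-hand side (\<open>solution_le\<close>). Letting \<open>m\<close> tend to 0 and exchanging the solutions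
  gives equality.
\<close>

section \<open>Integrable convolution kernels\<close>

lemma set_integrable_mult_bounded:
  fixes k h :: "real \<Rightarrow> real"
  assumes k: "set_integrable lborel A k" and h: "h \<in> borel_measurable borel"
    and bound: "\<And>x. \<bar>h x\<bar> \<le> B"
  shows "set_integrable lborel A (\<lambda>x. k x * h x)"
  unfolding set_integrable_def
proof (rule Bochner_Integration.integrable_bound)
  show "integrable lborel (\<lambda>x. (indicator A x *\<^sub>R k x) * B)"
    using k unfolding set_integrable_def by (intro integrable_mult_left) auto
  have "(\<lambda>x. indicator A x *\<^sub>R k x) \<in> borel_measurable lborel"
    using k unfolding set_integrable_def by (rule borel_measurable_integrable)
  then have "(\<lambda>x. (indicator A x *\<^sub>R k x) * h x) \<in> borel_measurable lborel"
    using h by (intro borel_measurable_times) auto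
  then show "(\<lambda>x. indicator A x *\<^sub>R (k x * h x)) \<in> borel_measurable lborel"
    by (simp add: mult.assoc)
  show "AE x in lborel. norm (indicator A x *\<^sub>R (k x * h x))
          \<le> norm ((indicator A x *\<^sub>R k x) * B)"
    using bound by (intro AE_I2) (auto simp: abs_mult indicator_def intro!: mult_left_mono order_trans[OF bound])
qed

lemma powr_kernel_integrable:
  fixes \<beta> t :: real
  assumes "\<beta> < 1"
  shows "set_integrable lborel {0<..<t} (\<lambda>r. r powr (- \<beta>))"
proof (cases "0 \<le> t")
  case True
  have "(\<lambda>r. r powr (- \<beta>)) integrable_on {0<..t}"
    using integrable_on_powr_from_0'[of "- \<beta>" t] assms True by simp
  then have "(\<lambda>r. r powr (- \<beta>)) absolutely_integrable_on {0<..t}"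
    by (subst absolutely_integrable_on_iff_nonneg) auto
  then have "set_integrable lborel {0<..t} (\<lambda>r. r powr (- \<beta>))"
    unfolding set_integrable_def by (subst (asm) integrable_completion) auto
  then show ?thesis
    by (rule set_integrable_subset) auto
qed (auto simp: set_integrable_def)

lemma reflect_interval_integral:
  fixes f :: "real \<Rightarrow> real"
  shows "(LBINT r:{0<..<t}. f r) = (LBINT s:{0<..<t}. f (t - s))"
    and "set_integrable lborel {0<..<t} f \<longleftrightarrow> set_integrable lborel {0<..<t} (\<lambda>s. f (t - s))"
proof -
  have ind: "indicat_real {0<..<t} (t - s) = indicator {0<..<t} s" for s
    by (auto simp: indicator_def)
  show "(LBINT r:{0<..<t}. f r) = (LBINT s:{0<..<t}. f (t - s))"
    unfolding set_lebesgue_integral_def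
    using lborel_integral_real_affine[of "-1" "\<lambda>r. indicat_real {0<..<t} r *\<^sub>R f r" t]
    by (simp add: ind)
  show "set_integrable lborel {0<..<t} f \<longleftrightarrow> set_integrable lborel {0<..<t} (\<lambda>s. f (t - s))"
    unfolding set_integrable_def
    using lborel_integrable_real_affine_iff[of "-1" "\<lambda>r. indicat_real {0<..<t} r *\<^sub>R f r" t]
    by (simp add: ind)
qed

lemma convolution_integrable:
  fixes k h :: "real \<Rightarrow> real"
  assumes k: "set_integrable lborel {0<..<T} k" and h: "continuous_on UNIV h"
    and bound: "\<And>x. \<bar>h x\<bar> \<le> B" and t: "t \<le> T"
  shows "set_integrable lborel {0<..<t} (\<lambda>r. k r * h (t - r))"
proof (rule set_integrable_mult_bounded)
  show "set_integrable lborel {0<..<t} k"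
    by (rule set_integrable_subset[OF k]) (use t in auto)
  show "(\<lambda>r. h (t - r)) \<in> borel_measurable borel"
    by (intro borel_measurable_continuous_onI continuous_on_compose2[OF h] continuous_intros) auto
qed (rule bound)

text \<open>
  Writing the convolution with \<open>h\<close> evaluated at \<open>t - r\<close> leaves the possibly singular kernel fixed, so that
  \<open>t\<close> enters only through the continuous \<open>h\<close> and the end point, and dominated convergence with
  the majorant \<open>B \<bar>k\<bar>\<close> applies.
\<close>

lemma continuous_on_convolution:
  fixes k h :: "real \<Rightarrow> real"
  assumes k: "set_integrable lborel {0<..<T} k" and h: "continuous_on UNIV h"
    and bound: "\<And>x. \<bar>h x\<bar> \<le> B"
  shows "continuous_on {0..T} (\<lambda>t. LBINT r:{0<..<t}. k r * h (t - r))"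
  unfolding continuous_on_sequentially
proof (intro allI ballI impI, elim conjE)
  fix x :: "nat \<Rightarrow> real" and t
  assume t: "t \<in> {0..T}" and x: "\<forall>n. x n \<in> {0..T}" and lim: "x \<longlonglongrightarrow> t"
  have "(\<lambda>n. \<integral>r. indicator {0<..<x n} r *\<^sub>R (k r * h (x n - r)) \<partial>lborel)
          \<longlonglongrightarrow> (\<integral>r. indicator {0<..<t} r *\<^sub>R (k r * h (t - r)) \<partial>lborel)"
  proof (rule integral_dominated_convergence)
    show "(\<lambda>r. indicator {0<..<t} r *\<^sub>R (k r * h (t - r))) \<in> borel_measurable lborel"
      using convolution_integrable[OF k h bound, of t] t
      unfolding set_integrable_def by (intro borel_measurable_integrable) auto
    show "(\<lambda>r. indicator {0<..<x n} r *\<^sub>R (k r * h (x n - r))) \<in> borel_measurable lborel" for n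
      using convolution_integrable[OF k h bound, of "x n"] x
      unfolding set_integrable_def by (intro borel_measurable_integrable) auto
    show "integrable lborel (\<lambda>r. norm ((indicator {0<..<T} r *\<^sub>R k r) * B))"
      using k unfolding set_integrable_def by (intro integrable_norm integrable_mult_left) auto
    show "AE r in lborel. norm (indicator {0<..<x n} r *\<^sub>R (k r * h (x n - r)))
            \<le> norm ((indicator {0<..<T} r *\<^sub>R k r) * B)" for n
    proof (intro AE_I2)
      fix r
      have xn: "x n \<le> T" using x by auto
      have "\<bar>k r\<bar> * \<bar>h (x n - r)\<bar> \<le> \<bar>k r\<bar> * \<bar>B\<bar>"
        using bound[of "x n - r"] by (intro mult_left_mono) auto
      then show "norm (indicator {0<..<x n} r *\<^sub>R (k r * h (x n - r)))
            \<le> norm ((indicator {0<..<T} r *\<^sub>R k r) * B)"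
        using xn by (auto simp: abs_mult indicator_def)
    qed
    \<comment> \<open>The moving end point of the integral is harmless: the indicators converge off \<open>r = t\<close>.\<close>
    have "AE r in lborel. r \<noteq> t"
      by (rule AE_lborel_singleton)
    then show "AE r in lborel. (\<lambda>n. indicator {0<..<x n} r *\<^sub>R (k r * h (x n - r)))
                 \<longlonglongrightarrow> indicator {0<..<t} r *\<^sub>R (k r * h (t - r))"
    proof eventually_elim
      fix r assume r: "r \<noteq> t"
      have hl: "(\<lambda>n. h (x n - r)) \<longlonglongrightarrow> h (t - r)"
        using h lim by (intro isCont_tendsto_compose[where g=h] tendsto_intros)
          (auto simp: continuous_on_eq_continuous_at)
      have "\<forall>\<^sub>F n in sequentially. indicat_real {0<..<x n} r = indicator {0<..<t} r"
      proof (cases "r < t")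
        case True
        then have "\<forall>\<^sub>F n in sequentially. r < x n" using lim by (simp add: order_tendsto_iff)
        then show ?thesis by eventually_elim (use True in \<open>auto simp: indicator_def\<close>)
      next
        case False
        then have "\<forall>\<^sub>F n in sequentially. x n < r" using lim r by (simp add: order_tendsto_iff)
        then show ?thesis by eventually_elim (use False in \<open>auto simp: indicator_def\<close>)
      qed
      then have "(\<lambda>n. indicat_real {0<..<x n} r) \<longlonglongrightarrow> indicator {0<..<t} r"
        by (rule tendsto_eventually)
      then show "(\<lambda>n. indicator {0<..<x n} r *\<^sub>R (k r * h (x n - r)))
                 \<longlonglongrightarrow> indicator {0<..<t} r *\<^sub>R (k r * h (t - r))"
        by (intro tendsto_intros hl)
    qed
  qed
  then show "((\<lambda>t. LBINT r:{0<..<t}. k r * h (t - r)) \<circ> x) \<longlonglongrightarrow> (LBINT r:{0<..<t}. k r * h (t - r))"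
    by (simp add: set_lebesgue_integral_def o_def)
qed

section \<open>Volterra equations of the second kind\<close>

text \<open>
  The weight \<open>exp (- n r)\<close> kills the kernel pointwise on \<open>r > 0\<close>, while \<open>\<bar>k\<bar>\<close> stays a majorant. This
  is what makes a Volterra operator a contraction in an exponentially weighted norm, however large
  \<open>k\<close> and \<open>T\<close> are.
\<close>

lemma exp_weight_kernel_tendsto_0:
  fixes k :: "real \<Rightarrow> real"
  assumes k: "set_integrable lborel {0<..<T} k"
  shows "set_integrable lborel {0<..<T} (\<lambda>r. k r * exp (- real n * r))"
    and "(\<lambda>n. LBINT r:{0<..<T}. \<bar>k r * exp (- real n * r)\<bar>) \<longlonglongrightarrow> 0"
proof -
  have meas: "(\<lambda>r. indicator {0<..<T} r *\<^sub>R k r) \<in> borel_measurable lborel"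
    using k unfolding set_integrable_def by (rule borel_measurable_integrable)
  have meas2: "(\<lambda>r. indicator {0<..<T} r *\<^sub>R (k r * exp (- real n * r))) \<in> borel_measurable lborel" for n
  proof -
    have "(\<lambda>r. (indicator {0<..<T} r *\<^sub>R k r) * exp (- real n * r)) \<in> borel_measurable lborel"
      using meas by (intro borel_measurable_times) auto
    then show ?thesis by (simp add: mult.assoc)
  qed
  have le: "norm (indicator {0<..<T} r *\<^sub>R (k r * exp (- real n * r)))
              \<le> norm (indicator {0<..<T} r *\<^sub>R k r)" for r n
    by (auto simp: abs_mult indicator_def intro!: mult_left_le)
  show "set_integrable lborel {0<..<T} (\<lambda>r. k r * exp (- real n * r))"
    using k meas2 le unfolding set_integrable_def
    by (rule Bochner_Integration.integrable_bound[OF _ _ AE_I2])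
  have "(\<lambda>n. \<integral>r. norm (indicator {0<..<T} r *\<^sub>R (k r * exp (- real n * r))) \<partial>lborel)
          \<longlonglongrightarrow> integral\<^sup>L (lborel :: real measure) (\<lambda>_. 0::real)"
  proof (rule integral_dominated_convergence)
    show "integrable lborel (\<lambda>r. norm (indicator {0<..<T} r *\<^sub>R k r))"
      using k unfolding set_integrable_def by (rule integrable_norm)
    show "(\<lambda>r. norm (indicator {0<..<T} r *\<^sub>R (k r * exp (- real n * r)))) \<in> borel_measurable lborel" for n
      by (rule measurable_compose[OF meas2 borel_measurable_norm])
    show "AE r in lborel. norm (norm (indicator {0<..<T} r *\<^sub>R (k r * exp (- real n * r))))
              \<le> norm (indicator {0<..<T} r *\<^sub>R k r)" for n
      using le by (intro AE_I2) simp
    show "AE r in lborel. (\<lambda>n. norm (indicator {0<..<T} r *\<^sub>R (k r * exp (- real n * r)))) \<longlonglongrightarrow> 0"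
    proof (intro AE_I2)
      fix r :: real
      show "(\<lambda>n. norm (indicator {0<..<T} r *\<^sub>R (k r * exp (- real n * r)))) \<longlonglongrightarrow> 0"
      proof (cases "0 < r")
        case True
        have "(\<lambda>n. exp (- r) ^ n) \<longlonglongrightarrow> 0"
          using True by (intro LIMSEQ_power_zero) simp
        moreover have "exp (- r) ^ n = exp (- real n * r)" for n
          using exp_of_nat_mult[of n "- r"] by simp
        ultimately have "(\<lambda>n. exp (- real n * r)) \<longlonglongrightarrow> 0"
          by simp
        then have "(\<lambda>n. norm (indicator {0<..<T} r *\<^sub>R (k r * exp (- real n * r))))
               \<longlonglongrightarrow> norm (indicator {0<..<T} r *\<^sub>R (k r * 0))"
          by (intro tendsto_intros)
        then show ?thesis by simp
      qed auto
    qed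
  qed auto
  then show "(\<lambda>n. LBINT r:{0<..<T}. \<bar>k r * exp (- real n * r)\<bar>) \<longlonglongrightarrow> 0"
    by (simp add: set_lebesgue_integral_def abs_mult)
qed

text \<open>
  A linear Volterra equation of the second kind with integrable convolution kernels. With
  \<open>h t = exp (- n t) g t\<close> as the unknown, each kernel acquires the factor \<open>exp (- n r)\<close>, and for large
  \<open>n\<close> the right-hand side is a contraction of the bounded continuous functions in the supremum norm.
  Outside \<open>[0, T]\<close> the solution is extended by its end values, so that the convolution lemmas apply
  to \<open>g\<close> itself.
\<close>

lemma volterra_convolution_exists:
  fixes k c :: "'i \<Rightarrow> real \<Rightarrow> real" and f :: "real \<Rightarrow> real"
  assumes T: "0 \<le> T" and I: "finite I"
    and k: "\<And>i. i \<in> I \<Longrightarrow> set_integrable lborel {0<..<T} (k i)"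
    and c: "\<And>i. i \<in> I \<Longrightarrow> continuous_on {0..T} (c i)"
    and f: "continuous_on {0..T} f"
  shows "\<exists>g. continuous_on UNIV g \<and> (\<exists>B. \<forall>t. \<bar>g t\<bar> \<le> B) \<and>
           (\<forall>t\<in>{0..T}. g t = f t + (\<Sum>i\<in>I. c i t * (LBINT r:{0<..<t}. k i r * g (t - r))))"
proof -
  have "\<exists>C. \<forall>i\<in>I. \<forall>t\<in>{0..T}. \<bar>c i t\<bar> \<le> C"
  proof -
    have "\<forall>i\<in>I. \<exists>C. \<forall>t\<in>{0..T}. \<bar>c i t\<bar> \<le> C"
    proof
      fix i assume "i \<in> I"
      then have "compact (c i ` {0..T})"
        by (intro compact_continuous_image c compact_Icc)
      then show "\<exists>C. \<forall>t\<in>{0..T}. \<bar>c i t\<bar> \<le> C"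
        by (auto dest!: compact_imp_bounded simp: bounded_iff)
    qed
    then obtain C where C: "\<And>i t. i \<in> I \<Longrightarrow> t \<in> {0..T} \<Longrightarrow> \<bar>c i t\<bar> \<le> C i"
      by metis
    have "\<bar>c i t\<bar> \<le> (\<Sum>i\<in>I. \<bar>C i\<bar>)" if "i \<in> I" "t \<in> {0..T}" for i t
    proof -
      have "\<bar>c i t\<bar> \<le> \<bar>C i\<bar>" using C[OF that] by simp
      also have "\<dots> \<le> (\<Sum>i\<in>I. \<bar>C i\<bar>)"
        by (rule member_le_sum) (use that I in auto)
      finally show ?thesis .
    qed
    then show ?thesis by blast
  qed
  then obtain C where C: "\<And>i t. i \<in> I \<Longrightarrow> t \<in> {0..T} \<Longrightarrow> \<bar>c i t\<bar> \<le> C"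
    by blast
  define K where "K n i r = k i r * exp (- real n * r)" for n :: nat and i r
  have "(\<lambda>n. \<Sum>i\<in>I. \<bar>C\<bar> * (LBINT r:{0<..<T}. \<bar>K n i r\<bar>)) \<longlonglongrightarrow> (\<Sum>i\<in>I. \<bar>C\<bar> * 0)"
    unfolding K_def using k by (intro tendsto_intros exp_weight_kernel_tendsto_0)
  then have "\<forall>\<^sub>F n in sequentially. (\<Sum>i\<in>I. \<bar>C\<bar> * (LBINT r:{0<..<T}. \<bar>K n i r\<bar>)) < 1 / 2"
    by (rule order_tendstoD(2)) simp
  then obtain n where n: "(\<Sum>i\<in>I. \<bar>C\<bar> * (LBINT r:{0<..<T}. \<bar>K n i r\<bar>)) < 1 / 2"
    using eventually_sequentially by auto
  have K: "set_integrable lborel {0<..<T} (K n i)" if "i \<in> I" for i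
    using exp_weight_kernel_tendsto_0(1)[OF k[OF that]] by (simp add: K_def[abs_def])
  \<comment> \<open>The retraction onto \<open>[0, T]\<close> turns functions on the interval into functions on the line.\<close>
  define \<tau> where "\<tau> t = max 0 (min T t)" for t :: real
  have \<tau>: "\<tau> t \<in> {0..T}" for t using T by (auto simp: \<tau>_def)
  have \<tau>_id: "\<tau> t = t" if "t \<in> {0..T}" for t using that by (auto simp: \<tau>_def)
  define F where "F h t = exp (- real n * t) * f t
      + (\<Sum>i\<in>I. c i t * (LBINT r:{0<..<t}. K n i r * h (t - r)))" for h :: "real \<Rightarrow> real" and t
  define \<Phi> where "\<Phi> h = Bcontfun (\<lambda>t. F (apply_bcontfun h) (\<tau> t))" for h :: "real \<Rightarrow>\<^sub>C real"
  have bnd: "\<exists>B. \<forall>t. \<bar>apply_bcontfun h t\<bar> \<le> B" for h :: "real \<Rightarrow>\<^sub>C real"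
    using bounded_apply_bcontfun[of h] by (auto simp: bounded_iff)
  have Fcont: "continuous_on {0..T} (F (apply_bcontfun h))" for h :: "real \<Rightarrow>\<^sub>C real"
  proof -
    obtain B where "\<And>t. \<bar>apply_bcontfun h t\<bar> \<le> B" using bnd by blast
    then show ?thesis
      unfolding F_def using c f K by (intro continuous_intros continuous_on_convolution[where B=B]) auto
  qed
  have "(\<lambda>t. F (apply_bcontfun h) (\<tau> t)) \<in> bcontfun" for h :: "real \<Rightarrow>\<^sub>C real"
  proof -
    have "continuous_on UNIV (\<lambda>t. F (apply_bcontfun h) (\<tau> t))"
      by (rule continuous_on_compose2[OF Fcont]) (use \<tau> in \<open>auto simp: \<tau>_def[abs_def] intro!: continuous_intros\<close>)
    moreover have "bounded (F (apply_bcontfun h) ` {0..T})"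
      by (intro compact_imp_bounded compact_continuous_image Fcont compact_Icc)
    then have "bounded (range (\<lambda>t. F (apply_bcontfun h) (\<tau> t)))"
      by (rule bounded_subset) (use \<tau> in auto)
    ultimately show ?thesis by (simp add: bcontfun_def)
  qed
  then have \<Phi>_apply: "apply_bcontfun (\<Phi> h) t = F (apply_bcontfun h) (\<tau> t)" for h t
    unfolding \<Phi>_def by (simp add: Bcontfun_inverse)
  have conv_diff: "\<bar>(LBINT r:{0<..<t}. K n i r * apply_bcontfun h (t - r))
                - (LBINT r:{0<..<t}. K n i r * apply_bcontfun h' (t - r))\<bar>
                \<le> dist h h' * (LBINT r:{0<..<T}. \<bar>K n i r\<bar>)"
    if i: "i \<in> I" and t: "t \<in> {0..T}" for i t and h h' :: "real \<Rightarrow>\<^sub>C real"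
  proof -
    have int: "set_integrable lborel {0<..<t} (\<lambda>r. K n i r * apply_bcontfun h (t - r))" for h :: "real \<Rightarrow>\<^sub>C real"
    proof -
      obtain B where "\<And>t. \<bar>apply_bcontfun h t\<bar> \<le> B" using bnd by blast
      then show ?thesis using K[OF i] t by (intro convolution_integrable) auto
    qed
    have "(LBINT r:{0<..<t}. K n i r * apply_bcontfun h (t - r))
            - (LBINT r:{0<..<t}. K n i r * apply_bcontfun h' (t - r))
        = (LBINT r:{0<..<t}. K n i r * apply_bcontfun h (t - r) - K n i r * apply_bcontfun h' (t - r))"
      by (rule set_integral_diff(2)[OF int int, symmetric])
    also have "\<bar>\<dots>\<bar> \<le> (\<integral>r. dist h h' * (indicator {0<..<T} r *\<^sub>R \<bar>K n i r\<bar>) \<partial>lborel)"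
      unfolding set_lebesgue_integral_def real_norm_def[symmetric]
    proof (rule Bochner_Integration.integral_norm_bound_integral)
      show "integrable lborel (\<lambda>r. indicator {0<..<t} r *\<^sub>R
              (K n i r * apply_bcontfun h (t - r) - K n i r * apply_bcontfun h' (t - r)))"
        using set_integral_diff(1)[OF int int] unfolding set_integrable_def .
      show "integrable lborel (\<lambda>r. dist h h' * (indicator {0<..<T} r *\<^sub>R norm (K n i r)))"
        using set_integrable_abs[OF K[OF i]] unfolding set_integrable_def
        by (intro integrable_mult_right) simp
      fix r
      have "\<bar>K n i r * apply_bcontfun h (t - r) - K n i r * apply_bcontfun h' (t - r)\<bar>
              = \<bar>K n i r\<bar> * dist (apply_bcontfun h (t - r)) (apply_bcontfun h' (t - r))"
        by (simp add: dist_real_def abs_mult right_diff_distrib[symmetric])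
      also have "\<dots> \<le> \<bar>K n i r\<bar> * dist h h'"
        by (intro mult_left_mono dist_bounded) simp
      finally show "norm (indicator {0<..<t} r *\<^sub>R
              (K n i r * apply_bcontfun h (t - r) - K n i r * apply_bcontfun h' (t - r)))
              \<le> dist h h' * (indicator {0<..<T} r *\<^sub>R norm (K n i r))"
        using t by (auto simp: indicator_def mult_ac)
    qed
    finally show ?thesis by (simp add: set_lebesgue_integral_def)
  qed
  have contr: "dist (\<Phi> h) (\<Phi> h') \<le> 1 / 2 * dist h h'" for h h'
  proof (rule dist_bound)
    fix t
    define s where "s = \<tau> t"
    have s: "s \<in> {0..T}" using \<tau> by (simp add: s_def)
    have "dist (apply_bcontfun (\<Phi> h) t) (apply_bcontfun (\<Phi> h') t)
        = \<bar>\<Sum>i\<in>I. c i s * ((LBINT r:{0<..<s}. K n i r * apply_bcontfun h (s - r))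
                - (LBINT r:{0<..<s}. K n i r * apply_bcontfun h' (s - r)))\<bar>"
      by (simp add: \<Phi>_apply F_def dist_real_def sum_subtractf right_diff_distrib s_def)
    also have "\<dots> \<le> (\<Sum>i\<in>I. \<bar>C\<bar> * (dist h h' * (LBINT r:{0<..<T}. \<bar>K n i r\<bar>)))"
      by (rule order_trans[OF sum_abs])
         (unfold abs_mult, intro sum_mono mult_mono conv_diff s, use C s in force, auto)
    also have "\<dots> = (\<Sum>i\<in>I. \<bar>C\<bar> * (LBINT r:{0<..<T}. \<bar>K n i r\<bar>)) * dist h h'"
      by (simp only: sum_distrib_right mult.assoc mult.commute[of "dist h h'"])
    also have "\<dots> \<le> 1 / 2 * dist h h'"
      using n by (intro mult_right_mono) auto
    finally show "dist (apply_bcontfun (\<Phi> h) t) (apply_bcontfun (\<Phi> h') t) \<le> 1 / 2 * dist h h'" .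
  qed
  obtain h where h: "\<Phi> h = h"
    using banach_fix_type[of "1 / 2" \<Phi>] contr by auto
  obtain B where B: "\<And>t. \<bar>apply_bcontfun h t\<bar> \<le> B" using bnd by blast
  define g where "g t = exp (real n * \<tau> t) * apply_bcontfun h t" for t
  have "\<bar>g t\<bar> \<le> exp (real n * T) * B" for t
    unfolding g_def abs_mult using \<tau>[of t] B[of t] by (intro mult_mono) (auto intro!: mult_left_mono)
  moreover have "continuous_on UNIV g"
    unfolding g_def \<tau>_def by (intro continuous_intros) auto
  moreover have "g t = f t + (\<Sum>i\<in>I. c i t * (LBINT r:{0<..<t}. k i r * g (t - r)))"
    if t: "t \<in> {0..T}" for t
  proof -
    have "(LBINT r:{0<..<t}. k i r * g (t - r))
        = (LBINT r:{0<..<t}. exp (real n * t) * (K n i r * apply_bcontfun h (t - r)))" for i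
    proof (rule set_lebesgue_integral_cong, goal_cases)
      case 2
      have "g (t - r) = exp (real n * t) * (exp (- real n * r) * apply_bcontfun h (t - r))"
        if "r \<in> {0<..<t}" for r
      proof -
        have "real n * (t - r) = real n * t + - real n * r"
          by (simp add: algebra_simps)
        then have "exp (real n * (t - r)) = exp (real n * t) * exp (- real n * r)"
          by (simp only: exp_add)
        moreover have "\<tau> (t - r) = t - r"
          using that t by (intro \<tau>_id) auto
        ultimately show ?thesis
          by (simp only: g_def mult.assoc)
      qed
      then show ?case by (simp add: K_def)
    qed auto
    then have conv: "(LBINT r:{0<..<t}. k i r * g (t - r))
        = exp (real n * t) * (LBINT r:{0<..<t}. K n i r * apply_bcontfun h (t - r))" for i
      by simp
    have "apply_bcontfun h t = F (apply_bcontfun h) t"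
      using \<Phi>_apply[of h t] \<tau>_id[OF t] h by simp
    then have "g t = exp (real n * t) * F (apply_bcontfun h) t"
      by (simp add: g_def \<tau>_id[OF t])
    also have "\<dots> = exp (real n * t) * (exp (- real n * t) * f t)
        + (\<Sum>i\<in>I. c i t * (exp (real n * t) * (LBINT r:{0<..<t}. K n i r * apply_bcontfun h (t - r))))"
      unfolding F_def distrib_left sum_distrib_left by (simp only: mult.left_commute)
    also have "exp (real n * t) * (exp (- real n * t) * f t) = f t"
      by (simp add: exp_minus)
    finally have "g t = f t + (\<Sum>i\<in>I. c i t *
        (exp (real n * t) * (LBINT r:{0<..<t}. K n i r * apply_bcontfun h (t - r))))" .
    then have "g t = f t + (\<Sum>i\<in>I. c i t * (LBINT r:{0<..<t}. k i r * g (t - r)))"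
      by (simp only: conv)
    then show ?thesis .
  qed
  ultimately show ?thesis by blast
qed

section \<open>The fundamental theorem of calculus for weak derivatives\<close>

text \<open>
  A test function that approximates the indicator of an interval needs a \<open>C\<^sup>1\<close> step whose derivative
  approximates a point mass. Second differences of the squared ramp provide one: the step is 0 for
  \<open>x \<le> 0\<close> and 1 for \<open>1 \<le> x\<close>, and its derivative is the piecewise linear hat on \<open>[0, 1]\<close> of
  height 2.
\<close>

definition ramp_sq :: "real \<Rightarrow> real" where
  "ramp_sq x = (max 0 x)\<^sup>2"

lemma DERIV_ramp_sq: "(ramp_sq has_real_derivative 2 * max 0 x) (at x)"
proof -
  consider "x < 0" | "x > 0" | "x = 0" by linarith
  then show ?thesis
  proof cases
    case 1
    have "((\<lambda>_. 0) has_real_derivative 0) (at x)" by simp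
    then have "(ramp_sq has_real_derivative 0) (at x)"
      by (rule has_field_derivative_transform_within_open[where S="{..<0}"])
         (use 1 in \<open>auto simp: ramp_sq_def\<close>)
    then show ?thesis using 1 by simp
  next
    case 2
    have "((\<lambda>x. x\<^sup>2) has_real_derivative 2 * x) (at x)"
      by (auto intro!: derivative_eq_intros)
    then have "(ramp_sq has_real_derivative 2 * x) (at x)"
      by (rule has_field_derivative_transform_within_open[where S="{0<..}"])
         (use 2 in \<open>auto simp: ramp_sq_def\<close>)
    then show ?thesis using 2 by simp
  next
    case 3
    have "((\<lambda>h::real. max 0 h) \<longlongrightarrow> max 0 0) (at 0)"
      by (intro tendsto_intros)
    moreover have "\<forall>\<^sub>F h in at (0::real). max 0 h = (ramp_sq h - ramp_sq 0) / h"
      by (auto simp: eventually_at_filter ramp_sq_def max_def power2_eq_square)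
    ultimately have "((\<lambda>h. (ramp_sq h - ramp_sq 0) / h) \<longlongrightarrow> 0) (at 0)"
      using tendsto_cong by fastforce
    then show ?thesis using 3 by (simp add: DERIV_def)
  qed
qed

definition smooth_step :: "real \<Rightarrow> real" where
  "smooth_step x = 2 * ramp_sq x - 4 * ramp_sq (x - 1 / 2) + 2 * ramp_sq (x - 1)"

definition hat :: "real \<Rightarrow> real" where
  "hat x = 4 * max 0 x - 8 * max 0 (x - 1 / 2) + 4 * max 0 (x - 1)"

lemma DERIV_smooth_step: "(smooth_step has_real_derivative hat x) (at x)"
proof -
  have "((\<lambda>x. ramp_sq (x - c)) has_real_derivative 2 * max 0 (x - c)) (at x)" for c
  proof -
    have "((\<lambda>x. x - c) has_real_derivative 1) (at x)"
      by (auto intro!: derivative_eq_intros)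
    from DERIV_chain2[OF DERIV_ramp_sq this] show ?thesis by simp
  qed
  from this[of "1/2"] this[of 1] DERIV_ramp_sq[of x] show ?thesis
    unfolding smooth_step_def[abs_def] hat_def
    by (auto intro!: derivative_eq_intros)
qed

lemma smooth_step_eq_0: "x \<le> 0 \<Longrightarrow> smooth_step x = 0"
  and smooth_step_eq_1: "1 \<le> x \<Longrightarrow> smooth_step x = 1"
  by (auto simp: smooth_step_def ramp_sq_def power2_eq_square algebra_simps)

lemma hat_eq_0: "x \<le> 0 \<or> 1 \<le> x \<Longrightarrow> hat x = 0"
  and hat_nonneg: "0 \<le> hat x"
  and continuous_on_hat: "continuous_on A hat"
  unfolding hat_def[abs_def] by (auto simp: max_def)[2] (intro continuous_intros)

lemma smooth_step_mono: "x \<le> y \<Longrightarrow> smooth_step x \<le> smooth_step y"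
  using DERIV_smooth_step hat_nonneg by (meson DERIV_nonneg_imp_nondecreasing)

lemma smooth_step_bounds: "0 \<le> smooth_step x" "smooth_step x \<le> 1"
  using smooth_step_mono[of "min x 0" x] smooth_step_mono[of x "max x 1"]
    smooth_step_eq_0[of "min x 0"] smooth_step_eq_1[of "max x 1"] by auto

lemma integral_hat: "integrable lborel hat" "(LBINT x. hat x) = 1"
proof -
  have eq: "hat = (\<lambda>x. indicator {0..1} x *\<^sub>R hat x)"
    proof
    show "hat x = indicator {0..1} x *\<^sub>R hat x" for x
      by (cases "x \<in> {0..1}") (auto simp: hat_eq_0)
  qed
  have int: "set_integrable lborel {0..1} hat"
    by (rule borel_integrable_atLeastAtMost') (rule continuous_on_hat)
  then show "integrable lborel hat"
    unfolding set_integrable_def eq[symmetric] .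
  have "(hat has_integral (smooth_step 1 - smooth_step 0)) {0..1}"
    by (rule fundamental_theorem_of_calculus)
       (auto intro!: has_real_derivative_iff_has_vector_derivative[THEN iffD1]
          DERIV_smooth_step has_field_derivative_at_within)
  then have "(LBINT x:{0..1}. hat x) = 1"
    using set_borel_integral_eq_integral(2)[OF int]
    by (simp add: integral_unique smooth_step_eq_0 smooth_step_eq_1)
  then show "(LBINT x. hat x) = 1"
    unfolding set_lebesgue_integral_def eq[symmetric] .
qed

text \<open>
  After the substitution \<open>x = a + y / (n + 1)\<close> the integrand converges to \<open>w a * hat y\<close> under the
  majorant \<open>B * hat y\<close>, and the hat has integral 1.
\<close>

lemma hat_approximates_identity:
  fixes w :: "real \<Rightarrow> real"
  assumes w: "continuous_on UNIV w" and bound: "\<And>x. \<bar>w x\<bar> \<le> B"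
  shows "integrable lborel (\<lambda>x. w x * (real (Suc n) * hat (real (Suc n) * (x - a))))"
    and "(\<lambda>n. LBINT x. w x * (real (Suc n) * hat (real (Suc n) * (x - a)))) \<longlonglongrightarrow> w a"
proof -
  let ?f = "\<lambda>n x. w x * (real (Suc n) * hat (real (Suc n) * (x - a)))"
  have wm: "(\<lambda>y. w (p + q * y)) \<in> borel_measurable lborel" for p q
  proof -
    have "continuous_on UNIV (\<lambda>y. w (p + q * y))"
      by (intro continuous_on_compose2[OF w] continuous_intros) auto
    then show ?thesis
      using borel_measurable_continuous_onI by simp
  qed
  have hm: "hat \<in> borel_measurable lborel"
    using borel_measurable_continuous_onI[OF continuous_on_hat] by simp
  have bd: "norm (w (a + 1 / real (Suc n) * y) * hat y) \<le> B * hat y" for n y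
    using bound hat_nonneg by (auto simp: abs_mult intro!: mult_right_mono)
  have sub: "?f n (a + 1 / real (Suc n) * y) = real (Suc n) * (w (a + 1 / real (Suc n) * y) * hat y)" for n y
    by (simp del: of_nat_Suc)
  have int: "integrable lborel (\<lambda>y. w (a + 1 / real (Suc n) * y) * hat y)" for n
  proof (rule Bochner_Integration.integrable_bound[where f="\<lambda>y. B * hat y"])
    show "integrable lborel (\<lambda>y. B * hat y)"
      using integral_hat by simp
    show "(\<lambda>y. w (a + 1 / real (Suc n) * y) * hat y) \<in> borel_measurable lborel"
      using wm hm by (intro borel_measurable_times)
    show "AE y in lborel. norm (w (a + 1 / real (Suc n) * y) * hat y) \<le> norm (B * hat y)"
      using order_trans[OF bd abs_ge_self] by (intro AE_I2) simp
  qed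
  then have "integrable lborel (\<lambda>y. ?f n (a + 1 / real (Suc n) * y))" for n
    unfolding sub by (rule integrable_mult_right)
  then show "integrable lborel (?f n)" for n
    by (subst (asm) lborel_integrable_real_affine_iff) (auto simp del: of_nat_Suc)
  have "(LBINT x. ?f n x) = (LBINT y. w (a + 1 / real (Suc n) * y) * hat y)" for n
    by (subst lborel_integral_real_affine[where c="1 / real (Suc n)" and t=a])
       (simp_all only: sub, simp_all del: of_nat_Suc)
  moreover have "(\<lambda>n. LBINT y. w (a + 1 / real (Suc n) * y) * hat y) \<longlonglongrightarrow> (LBINT y. w a * hat y)"
  proof (rule integral_dominated_convergence)
    show "integrable lborel (\<lambda>y. B * hat y)"
      using integral_hat by simp
    show "AE y in lborel. (\<lambda>n. w (a + 1 / real (Suc n) * y) * hat y) \<longlonglongrightarrow> w a * hat y"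
    proof (intro AE_I2 tendsto_intros)
      fix y :: real
      have "(\<lambda>n. a + 1 / real (Suc n) * y) \<longlonglongrightarrow> a + 0 * y"
        by (intro tendsto_intros LIMSEQ_Suc[OF lim_1_over_n])
      then show "(\<lambda>n. w (a + 1 / real (Suc n) * y)) \<longlonglongrightarrow> w a"
        using w by (intro isCont_tendsto_compose[where g=w])
          (auto simp: continuous_on_eq_continuous_at)
    qed
    show "(\<lambda>y. w (a + 1 / real (Suc n) * y) * hat y) \<in> borel_measurable lborel" for n
      using wm hm by (intro borel_measurable_times)
    show "(\<lambda>y. w a * hat y) \<in> borel_measurable lborel"
      using hm by (intro borel_measurable_times) auto
  qed (use bd in \<open>auto intro!: AE_I2\<close>)
  ultimately show "(\<lambda>n. LBINT x. ?f n x) \<longlonglongrightarrow> w a"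
    by (simp add: integral_hat)
qed

lemma weak_derivative_test:
  assumes wd: "weak_derivative l u w g" and "l < a" "b < u"
    and \<phi>: "\<And>x. (\<phi> has_real_derivative \<phi>' x) (at x)" and \<phi>': "continuous_on UNIV \<phi>'"
    and supp: "\<And>x. x \<notin> {a..b} \<Longrightarrow> \<phi> x = 0"
  shows "(LBINT x:{l<..<u}. w x * \<phi>' x) = - (LBINT x:{l<..<u}. g x * \<phi> x)"
proof -
  have "test_function l u \<phi>"
    unfolding test_function_def C1_differentiable_on_def
    using assms by (auto simp: has_real_derivative_iff_has_vector_derivative)
  moreover have "deriv \<phi> = \<phi>'"
    using \<phi> by (auto intro: DERIV_imp_deriv)
  ultimately show ?thesis
    using wd unfolding weak_derivative_def by metis
qed

text \<open>
  Test the weak derivative with a smoothed indicator of \<open>(a, b]\<close>, namely a step up just to the right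
  of \<open>a\<close> minus a step up just to the right of \<open>b\<close>. Its derivative is a difference of approximate
  point masses, so the left-hand side tends to \<open>w a - w b\<close>; the test functions themselves tend to
  the indicator boundedly, so the right-hand side tends to minus the integral of \<open>g\<close>.
\<close>

lemma weak_derivative_ftc:
  assumes wd: "weak_derivative l u w g" and w: "continuous_on {l<..<u} w"
    and ab: "l < a" "a \<le> b" "b < u"
  shows "set_integrable lborel {a<..b} g" and "w b - w a = (LBINT x:{a<..b}. g x)"
proof -
  define d where "d = (b + u) / 2"
  have d: "b < d" "d < u" using ab by (auto simp: d_def)
  have g_ad: "set_integrable lborel {a..d} g"
    using wd ab d unfolding weak_derivative_def locally_integrable_def by auto
  then show g_ab: "set_integrable lborel {a<..b} g"
    by (rule set_integrable_subset) (use d in auto)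
  \<comment> \<open>Only values on \<open>[a, d]\<close> are ever tested; \<open>W\<close> is bounded and continuous everywhere.\<close>
  define W where "W x = w (max a (min d x))" for x
  have W_cont: "continuous_on UNIV W"
    unfolding W_def by (rule continuous_on_compose2[OF w]) (use ab d in \<open>auto intro!: continuous_intros\<close>)
  have "bounded (w ` {a..d})"
    by (intro compact_imp_bounded compact_continuous_image continuous_on_subset[OF w]) (use ab d in auto)
  then obtain B where "\<And>x. x \<in> {a..d} \<Longrightarrow> \<bar>w x\<bar> \<le> B"
    unfolding bounded_iff by (metis imageI real_norm_def)
  then have W_bound: "\<bar>W x\<bar> \<le> B" for x
    unfolding W_def using ab d by auto
  define \<phi> where "\<phi> n x = smooth_step (real (Suc n) * (x - a)) - smooth_step (real (Suc n) * (x - b))" for n x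
  define \<phi>' where "\<phi>' n x = real (Suc n) * hat (real (Suc n) * (x - a))
      - real (Suc n) * hat (real (Suc n) * (x - b))" for n x
  have der: "(\<phi> n has_real_derivative \<phi>' n x) (at x)" for n x
  proof -
    have "((\<lambda>x. smooth_step (real (Suc n) * (x - p))) has_real_derivative
            hat (real (Suc n) * (x - p)) * real (Suc n)) (at x)" for p
      by (rule DERIV_chain2[OF DERIV_smooth_step]) (auto intro!: derivative_eq_intros)
    from DERIV_diff[OF this this] show ?thesis
      by (simp add: \<phi>_def[abs_def] \<phi>'_def mult.commute)
  qed
  have \<phi>'_cont: "continuous_on UNIV (\<phi>' n)" for n
    unfolding \<phi>'_def by (intro continuous_intros continuous_on_compose2[OF continuous_on_hat[of UNIV]]) auto
  have \<phi>_le: "\<bar>\<phi> n x\<bar> \<le> 1" for n x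
    unfolding \<phi>_def
    using smooth_step_bounds[of "real (Suc n) * (x - a)"] smooth_step_bounds[of "real (Suc n) * (x - b)"] by linarith
  obtain N where N: "1 / real (Suc N) < d - b"
    using d nat_approx_posE[of "d - b"] by auto
  \<comment> \<open>From index \<open>N\<close> on, the test functions live on \<open>[a, d]\<close>.\<close>
  have big: "1 \<le> real (Suc n) * (x - p)" if "n \<ge> N" "x > d" "p \<le> b" for n x p
  proof -
    have "1 = real (Suc n) * (1 / real (Suc n))" by simp
    also have "\<dots> \<le> real (Suc n) * (1 / real (Suc N))"
      using that by (intro mult_left_mono divide_left_mono) auto
    also have "\<dots> \<le> real (Suc n) * (x - p)"
      using that N by (intro mult_left_mono) auto
    finally show ?thesis .
  qed
  have small: "real (Suc n) * (x - p) \<le> 0" if "x \<le> p" for n x p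
    using that by (intro mult_nonneg_nonpos) auto
  have supp: "\<phi> n x = 0" "\<phi>' n x = 0" if "n \<ge> N" "x \<notin> {a..d}" for n x
  proof -
    have "x < a \<or> x > d" using that by auto
    then show "\<phi> n x = 0" "\<phi>' n x = 0"
      unfolding \<phi>_def \<phi>'_def using that ab small[of x a n] small[of x b n] big[of n x a] big[of n x b]
      by (auto simp del: of_nat_Suc simp: smooth_step_eq_0 smooth_step_eq_1 hat_eq_0)
  qed
  have "(\<lambda>n. (LBINT x. W x * (real (Suc n) * hat (real (Suc n) * (x - a))))
           - (LBINT x. W x * (real (Suc n) * hat (real (Suc n) * (x - b))))) \<longlonglongrightarrow> W a - W b"
    by (intro tendsto_diff hat_approximates_identity[OF W_cont W_bound])
  moreover have "(LBINT x. W x * (real (Suc n) * hat (real (Suc n) * (x - a))))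
           - (LBINT x. W x * (real (Suc n) * hat (real (Suc n) * (x - b))))
        = - (LBINT x:{l<..<u}. g x * \<phi> n x)" if n: "n \<ge> N" for n
  proof -
    have eq: "W x * \<phi>' n x = W x * (real (Suc n) * hat (real (Suc n) * (x - a)))
        - W x * (real (Suc n) * hat (real (Suc n) * (x - b)))" for x
      by (simp only: \<phi>'_def right_diff_distrib[of "W x"])
    have "(LBINT x. W x * (real (Suc n) * hat (real (Suc n) * (x - a))))
           - (LBINT x. W x * (real (Suc n) * hat (real (Suc n) * (x - b))))
        = (LBINT x. W x * \<phi>' n x)"
      unfolding eq
      by (rule Bochner_Integration.integral_diff[symmetric]) (rule hat_approximates_identity[OF W_cont W_bound])+
    also have "\<dots> = (LBINT x:{l<..<u}. w x * \<phi>' n x)"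
      unfolding set_lebesgue_integral_def
    proof (rule Bochner_Integration.integral_cong)
      fix x
      show "W x * \<phi>' n x = indicator {l<..<u} x *\<^sub>R (w x * \<phi>' n x)"
        using supp(2)[OF n, of x] ab d by (cases "x \<in> {a..d}") (auto simp: W_def)
    qed simp
    also have "\<dots> = - (LBINT x:{l<..<u}. g x * \<phi> n x)"
      by (rule weak_derivative_test[OF wd \<open>l < a\<close> \<open>d < u\<close> der \<phi>'_cont supp(1)[OF n]])
    finally show ?thesis .
  qed
  then have "\<forall>\<^sub>F n in sequentially. (LBINT x. W x * (real (Suc n) * hat (real (Suc n) * (x - a))))
           - (LBINT x. W x * (real (Suc n) * hat (real (Suc n) * (x - b))))
        = - (LBINT x:{l<..<u}. g x * \<phi> n x)"
    by (intro eventually_sequentiallyI[of N])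
  ultimately have lim1: "(\<lambda>n. - (LBINT x:{l<..<u}. g x * \<phi> n x)) \<longlonglongrightarrow> W a - W b"
    using tendsto_cong by fast
  have g_eq: "(LBINT x:{l<..<u}. g x * \<phi> n x) = (\<integral>x. (indicator {a..d} x *\<^sub>R g x) * \<phi> n x \<partial>lborel)"
    if n: "n \<ge> N" for n
    unfolding set_lebesgue_integral_def
  proof (rule Bochner_Integration.integral_cong)
    fix x
    show "indicator {l<..<u} x *\<^sub>R (g x * \<phi> n x) = (indicator {a..d} x *\<^sub>R g x) * \<phi> n x"
      using supp(1)[OF n, of x] ab d by (cases "x \<in> {a..d}") auto
  qed simp
  have gm: "(\<lambda>x. indicator {a..d} x *\<^sub>R g x) \<in> borel_measurable lborel"
    using g_ad unfolding set_integrable_def by (rule borel_measurable_integrable)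
  have "(\<lambda>n. \<integral>x. (indicator {a..d} x *\<^sub>R g x) * \<phi> n x \<partial>lborel)
          \<longlonglongrightarrow> (\<integral>x. (indicator {a..d} x *\<^sub>R g x) * indicator {a<..b} x \<partial>lborel)"
  proof (rule integral_dominated_convergence)
    show "integrable lborel (\<lambda>x. norm (indicator {a..d} x *\<^sub>R g x))"
      using g_ad unfolding set_integrable_def by (rule integrable_norm)
    show "(\<lambda>x. (indicator {a..d} x *\<^sub>R g x) * indicator {a<..b} x) \<in> borel_measurable lborel"
      using gm by (rule borel_measurable_times) auto
    have "\<phi> n \<in> borel_measurable borel" for n
      by (intro borel_measurable_continuous_onI DERIV_continuous_on[of UNIV "\<phi> n"]) (rule der)
    then show "(\<lambda>x. (indicator {a..d} x *\<^sub>R g x) * \<phi> n x) \<in> borel_measurable lborel" for n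
      using gm by (intro borel_measurable_times) auto
    show "AE x in lborel. norm ((indicator {a..d} x *\<^sub>R g x) * \<phi> n x)
            \<le> norm (indicator {a..d} x *\<^sub>R g x)" for n
      using \<phi>_le by (intro AE_I2) (auto simp: abs_mult intro!: mult_left_le)
    have step: "(\<lambda>n. smooth_step (real (Suc n) * (x - p))) \<longlonglongrightarrow> (if p < x then 1 else 0)" for x p
    proof (cases "p < x")
      case True
      then obtain M where M: "1 / real (Suc M) < x - p" using nat_approx_posE[of "x - p"] by auto
      have "1 \<le> real (Suc n) * (x - p)" if "n \<ge> M" for n
      proof -
        have "1 \<le> real (Suc M) * (x - p)" using M by (simp add: field_simps del: of_nat_Suc)
        also have "\<dots> \<le> real (Suc n) * (x - p)" using that True by (intro mult_right_mono) auto
        finally show ?thesis .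
      qed
      then have "\<forall>\<^sub>F n in sequentially. smooth_step (real (Suc n) * (x - p)) = 1"
        by (intro eventually_sequentiallyI[of M] smooth_step_eq_1)
      then show ?thesis using True by (simp add: tendsto_eventually del: of_nat_Suc)
    next
      case False
      then show ?thesis using small[of x p] by (simp add: smooth_step_eq_0 del: of_nat_Suc)
    qed
    show "AE x in lborel. (\<lambda>n. (indicator {a..d} x *\<^sub>R g x) * \<phi> n x)
            \<longlonglongrightarrow> (indicator {a..d} x *\<^sub>R g x) * indicator {a<..b} x"
    proof (intro AE_I2 tendsto_mult tendsto_const)
      fix x
      have "\<phi> n x = smooth_step (real (Suc n) * (x - a)) - smooth_step (real (Suc n) * (x - b))" for n
        by (simp add: \<phi>_def)
      moreover have "indicat_real {a<..b} x = (if a < x then 1 else 0) - (if b < x then 1 else 0)"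
        using ab by (auto simp: indicator_def)
      ultimately show "(\<lambda>n. \<phi> n x) \<longlonglongrightarrow> indicator {a<..b} x"
        using tendsto_diff[OF step[where p=a] step[where p=b], of x x] by (simp del: of_nat_Suc)
    qed
  qed
  then have "(\<lambda>n. LBINT x:{l<..<u}. g x * \<phi> n x)
          \<longlonglongrightarrow> (\<integral>x. (indicator {a..d} x *\<^sub>R g x) * indicator {a<..b} x \<partial>lborel)"
    by (rule Lim_transform_eventually) (use g_eq in \<open>auto intro!: eventually_sequentiallyI[of N]\<close>)
  moreover have "(\<integral>x. (indicator {a..d} x *\<^sub>R g x) * indicator {a<..b} x \<partial>lborel) = (LBINT x:{a<..b}. g x)"
    unfolding set_lebesgue_integral_def using d
    by (intro Bochner_Integration.integral_cong) (auto simp: indicator_def)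
  ultimately have "(\<lambda>n. - (LBINT x:{l<..<u}. g x * \<phi> n x)) \<longlonglongrightarrow> - (LBINT x:{a<..b}. g x)"
    by (simp add: tendsto_minus)
  then have "W a - W b = - (LBINT x:{a<..b}. g x)"
    using lim1 LIMSEQ_unique by blast
  then show "w b - w a = (LBINT x:{a<..b}. g x)"
    using ab d by (simp add: W_def)
qed

section \<open>Left-continuous representatives of the derivative\<close>

text \<open>
  This mean value estimate turns one-sided information about the representative \<open>dw\<close> into
  information about increments of \<open>w\<close>. The end point \<open>d\<close> may be \<open>T\<close> itself, where no test function
  reaches; there the estimate follows by continuity of \<open>w\<close>.
\<close>

lemma derivative_increment_estimate:
  assumes ld: "left_continuous_derivative T w dw" and w: "continuous_on {0..T} w"
    and cd: "0 \<le> c" "d \<le> T" and near: "\<And>x. x \<in> {c<..<d} \<Longrightarrow> \<bar>dw x - m\<bar> \<le> e"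
    and ab: "c < a" "a \<le> b" "b \<le> d"
  shows "\<bar>w b - w a - m * (b - a)\<bar> \<le> e * (b - a)"
proof -
  have interior: "\<bar>w b - w a - m * (b - a)\<bar> \<le> e * (b - a)" if ab: "c < a" "a \<le> b" "b < d" for b
  proof -
    have wd: "weak_derivative (a / 2) T w dw"
      using ld ab cd unfolding left_continuous_derivative_def by auto
    have wc: "continuous_on {a / 2<..<T} w"
      by (rule continuous_on_subset[OF w]) (use ab cd in auto)
    have l: "a / 2 < a" "b < T" using ab cd by auto
    note ftc = weak_derivative_ftc[OF wd wc l(1) ab(2) l(2)]
    have const: "set_integrable lborel {a<..b} (\<lambda>_. m)" "(LBINT x:{a<..b}. m) = m * (b - a)" for m :: real
      using ab unfolding set_integrable_def set_lebesgue_integral_def by auto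
    have "w b - w a - m * (b - a) = (LBINT x:{a<..b}. dw x - m)"
      using set_integral_diff(2)[OF ftc(1) const(1)] ftc(2) const(2) by simp
    also have "\<bar>\<dots>\<bar> \<le> (LBINT x:{a<..b}. e)"
      unfolding set_lebesgue_integral_def real_norm_def[symmetric]
    proof (rule Bochner_Integration.integral_norm_bound_integral)
      show "integrable lborel (\<lambda>x. indicator {a<..b} x *\<^sub>R (dw x - m))"
        using set_integral_diff(1)[OF ftc(1) const(1)] unfolding set_integrable_def .
      show "integrable lborel (\<lambda>x. indicator {a<..b} x *\<^sub>R e)"
        using const(1) unfolding set_integrable_def .
      show "norm (indicator {a<..b} x *\<^sub>R (dw x - m)) \<le> indicator {a<..b} x *\<^sub>R e" for x
        using near[of x] ab by (auto simp: indicator_def)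
    qed
    also have "\<dots> = e * (b - a)" by (rule const(2))
    finally show ?thesis .
  qed
  show ?thesis
  proof (cases "b < d \<or> a = b")
    case True
    then show ?thesis using interior ab by auto
  next
    case False
    then have b: "b = d" "a < b" using ab by auto
    have wb: "(w \<longlongrightarrow> w b) (at b within {a<..<b})"
    proof -
      have "(w \<longlongrightarrow> w b) (at b within {0..T})"
        using w b ab cd unfolding continuous_on_def by auto
      then show ?thesis
        by (rule tendsto_within_subset) (use b ab cd in auto)
    qed
    then have "((\<lambda>x. e * (x - a) - \<bar>w x - w a - m * (x - a)\<bar>) \<longlongrightarrow>
        e * (b - a) - \<bar>w b - w a - m * (b - a)\<bar>) (at b within {a<..<b})"
      by (intro tendsto_intros)
    moreover have "\<forall>\<^sub>F x in at b within {a<..<b}. 0 \<le> e * (x - a) - \<bar>w x - w a - m * (x - a)\<bar>"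
      using interior b ab by (auto simp: eventually_at_filter)
    moreover have "at b within {a<..<b} \<noteq> bot"
      using b by (simp add: at_within_eq_bot_iff)
    ultimately have "0 \<le> e * (b - a) - \<bar>w b - w a - m * (b - a)\<bar>"
      by (intro tendsto_lowerbound)
    then show ?thesis by simp
  qed
qed

lemma derivative_from_left:
  assumes ld: "left_continuous_derivative T w dw" and w: "continuous_on {0..T} w"
    and t: "0 < t" "t \<le> T" and e: "0 < e"
  obtains \<delta> where "0 < \<delta>" "\<delta> \<le> t"
    "\<And>s. t - \<delta> < s \<Longrightarrow> s \<le> t \<Longrightarrow> \<bar>w t - w s - dw t * (t - s)\<bar> \<le> e * (t - s)"
proof -
  have "continuous (at_left t) dw"
    using ld t unfolding left_continuous_derivative_def by auto
  then have "(dw \<longlongrightarrow> dw t) (at_left t)"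
    by (simp add: continuous_within)
  then have "\<forall>\<^sub>F x in at_left t. dist (dw x) (dw t) < e"
    using e by (rule tendstoD)
  then obtain b where b: "b < t" "\<And>x. b < x \<Longrightarrow> x < t \<Longrightarrow> dist (dw x) (dw t) < e"
    using t eventually_at_left[of 0 t] by auto
  show ?thesis
  proof (rule that[of "min t (t - b)"])
    fix s assume s: "t - min t (t - b) < s" "s \<le> t"
    show "\<bar>w t - w s - dw t * (t - s)\<bar> \<le> e * (t - s)"
      by (rule derivative_increment_estimate[OF ld w, of "t - min t (t - b)" t])
         (use s b t in \<open>auto simp: dist_real_def less_imp_le\<close>)
  qed (use b t in auto)
qed

lemma derivative_at_continuity_point:
  assumes ld: "left_continuous_derivative T w dw" and w: "continuous_on {0..T} w"
    and t: "0 < t" "t < T" and cont: "isCont dw t"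
  shows "(w has_real_derivative dw t) (at t)"
  unfolding has_field_derivative_def has_derivative_within_alt
proof (intro conjI allI impI)
  fix e :: real assume "0 < e"
  then obtain \<delta> where \<delta>: "\<delta> > 0" "\<And>x. dist x t < \<delta> \<Longrightarrow> dist (dw x) (dw t) < e"
    using cont unfolding continuous_at_eps_delta by (auto simp: dist_real_def)
  define r where "r = min \<delta> (min t (T - t))"
  have r: "0 < r" "r \<le> \<delta>" "r \<le> t" "r \<le> T - t" using \<delta> t by (auto simp: r_def)
  have est: "\<bar>w b - w a - dw t * (b - a)\<bar> \<le> e * (b - a)" if "t - r < a" "a \<le> b" "b < t + r" for a b
  proof (rule derivative_increment_estimate[OF ld w, of "t - r" "t + r"])
    show "\<bar>dw x - dw t\<bar> \<le> e" if "x \<in> {t - r<..<t + r}" for x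
    proof -
      have "\<bar>x - t\<bar> < \<delta>" using that r by (auto simp: abs_less_iff)
      then show ?thesis using \<delta>(2)[of x] by (simp add: dist_real_def)
    qed
  qed (use that r in auto)
  show "\<exists>d>0. \<forall>y\<in>UNIV. norm (y - t) < d \<longrightarrow> norm (w y - w t - dw t * (y - t)) \<le> e * norm (y - t)"
  proof (intro exI[of _ r] conjI ballI impI)
    fix y assume "norm (y - t) < r"
    then have y: "t - r < y" "y < t + r" by (auto simp: abs_less_iff)
    show "norm (w y - w t - dw t * (y - t)) \<le> e * norm (y - t)"
    proof (cases "y \<le> t")
      case True
      have "w y - w t - dw t * (y - t) = - (w t - w y - dw t * (t - y))" by (simp add: algebra_simps)
      then show ?thesis using est[of y t] y r True by (simp add: abs_minus_commute)
    next
      case False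
      then show ?thesis using est[of t y] y r by simp
    qed
  qed (use r in auto)
qed (auto intro: bounded_linear_mult_right)

text \<open>
  Near \<open>t\<close> the bound comes from the left derivative, and further away from the boundedness of \<open>w\<close>
  and of \<open>1 / (t - s)\<close>. The derivative may be unbounded near 0, so only increments that end at \<open>t\<close>
  are controlled.
\<close>

lemma lipschitz_from_left:
  assumes ld: "left_continuous_derivative T w dw" and w: "continuous_on {0..T} w"
    and t: "0 < t" "t \<le> T"
  obtains L where "0 \<le> L" "\<And>s. s \<in> {0..t} \<Longrightarrow> \<bar>w t - w s\<bar> \<le> L * (t - s)"
proof -
  obtain \<delta> where \<delta>: "0 < \<delta>" "\<delta> \<le> t"
    "\<And>s. t - \<delta> < s \<Longrightarrow> s \<le> t \<Longrightarrow> \<bar>w t - w s - dw t * (t - s)\<bar> \<le> 1 * (t - s)"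
    using derivative_from_left[OF ld w t, of 1] by auto
  have "bounded (w ` {0..T})"
    by (intro compact_imp_bounded compact_continuous_image w compact_Icc)
  then obtain M where M: "\<And>x. x \<in> {0..T} \<Longrightarrow> \<bar>w x\<bar> \<le> M"
    unfolding bounded_iff by (metis imageI real_norm_def)
  define L where "L = max (1 + \<bar>dw t\<bar>) (2 * M / \<delta>)"
  have M0: "0 \<le> M" using M[of t] t by auto
  have "\<bar>w t - w s\<bar> \<le> L * (t - s)" if s: "s \<in> {0..t}" for s
  proof (cases "t - \<delta> < s")
    case True
    have "\<bar>w t - w s\<bar> \<le> \<bar>w t - w s - dw t * (t - s)\<bar> + \<bar>dw t * (t - s)\<bar>" by arith
    also have "\<dots> \<le> (1 + \<bar>dw t\<bar>) * (t - s)"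
    proof -
      have "\<bar>dw t * (t - s)\<bar> = \<bar>dw t\<bar> * (t - s)" using s by (simp add: abs_mult)
      then show ?thesis using \<delta>(3)[of s] True s by (simp add: distrib_right)
    qed
    also have "\<dots> \<le> L * (t - s)"
      using s by (intro mult_right_mono) (auto simp: L_def)
    finally show ?thesis .
  next
    case False
    have "\<bar>w t - w s\<bar> \<le> 2 * M / \<delta> * \<delta>" using M[of t] M[of s] s t \<delta> by auto
    also have "\<dots> \<le> 2 * M / \<delta> * (t - s)"
      using False M0 \<delta> by (intro mult_left_mono) auto
    also have "\<dots> \<le> L * (t - s)"
      using s by (intro mult_right_mono) (auto simp: L_def)
    finally show ?thesis .
  qed
  then show ?thesis by (intro that[of L]) (auto simp: L_def)
qed

section \<open>Caputo derivatives and the comparison principle\<close>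

text \<open>
  The factor \<open>w t - w s\<close> contributes one power of \<open>t - s\<close>, which leaves the integrable singularity
  \<open>(t - s) powr (- \<alpha>)\<close>.
\<close>

lemma reformulated_integrand_integrable:
  assumes ld: "left_continuous_derivative T w dw" and w: "continuous_on {0..T} w"
    and t: "0 < t" "t \<le> T" and \<alpha>: "0 < \<alpha>" "\<alpha> < 1"
  shows "set_integrable lborel {0<..<t} (\<lambda>s. \<alpha> * (t - s) powr (- \<alpha> - 1) * (w t - w s))"
proof -
  obtain L where L: "0 \<le> L" "\<And>s. s \<in> {0..t} \<Longrightarrow> \<bar>w t - w s\<bar> \<le> L * (t - s)"
    using lipschitz_from_left[OF ld w t] by blast
  show ?thesis
  proof (rule set_integrable_bound)
    have "set_integrable lborel {0<..<t} (\<lambda>s. (t - s) powr (- \<alpha>))"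
      using powr_kernel_integrable[of \<alpha> t] \<alpha> by (subst (asm) reflect_interval_integral) auto
    then show "set_integrable lborel {0<..<t} (\<lambda>s. \<alpha> * L * (t - s) powr (- \<alpha>))"
      by (rule set_integrable_mult_right)
    have "continuous_on {0<..<t} (\<lambda>s. \<alpha> * (t - s) powr (- \<alpha> - 1) * (w t - w s))"
      by (intro continuous_intros continuous_on_subset[OF w]) (use t in auto)
    from borel_measurable_continuous_on_indicator[OF borel_open[OF open_greaterThanLessThan] this]
    show "set_borel_measurable lborel {0<..<t} (\<lambda>s. \<alpha> * (t - s) powr (- \<alpha> - 1) * (w t - w s))"
      by (simp add: set_borel_measurable_def)
    show "AE s in lborel. s \<in> {0<..<t} \<longrightarrow> norm (\<alpha> * (t - s) powr (- \<alpha> - 1) * (w t - w s))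
            \<le> norm (\<alpha> * L * (t - s) powr (- \<alpha>))"
    proof (intro AE_I2 impI)
      fix s assume s: "s \<in> {0<..<t}"
      have "(t - s) powr (- \<alpha> - 1) * \<bar>w t - w s\<bar> \<le> (t - s) powr (- \<alpha> - 1) * (L * (t - s))"
        using L(2)[of s] s by (intro mult_left_mono) auto
      also have "\<dots> = L * (t - s) powr (- \<alpha>)"
        using s powr_add[of "t - s" "- \<alpha> - 1" 1] by simp
      finally show "norm (\<alpha> * (t - s) powr (- \<alpha> - 1) * (w t - w s)) \<le> norm (\<alpha> * L * (t - s) powr (- \<alpha>))"
        using \<alpha> L by (simp add: abs_mult mult.assoc)
    qed
  qed
qed

text \<open>
  Integration by parts: off the finitely many jumps of \<open>dw\<close>, the function
  \<open>F s = (t - s) powr (- \<alpha>) * (w t - w s)\<close> has as its derivative the difference of the two integrands.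
  By the Lipschitz bound it extends continuously by 0 to \<open>s = t\<close> (the value that \<open>0 powr (- \<alpha>) = 0\<close>
  gives), so the fundamental theorem of calculus applies on all of \<open>[0, t]\<close>, and \<open>F 0\<close> is the
  boundary term of the reformulation.
\<close>

lemma caputo_classical_eq_reformulated:
  assumes ld: "left_continuous_derivative T w dw" and w: "continuous_on {0..T} w"
    and t: "0 < t" "t \<le> T" and \<alpha>: "0 < \<alpha>" "\<alpha> < 1"
    and int: "set_integrable lborel {0<..<t} (\<lambda>s. (t - s) powr (- \<alpha>) * dw s)"
  shows "caputo_classical \<alpha> dw t = caputo_reformulated \<alpha> w t"
proof -
  define F where "F s = (t - s) powr (- \<alpha>) * (w t - w s)" for s
  define f where "f s = \<alpha> * (t - s) powr (- \<alpha> - 1) * (w t - w s) - (t - s) powr (- \<alpha>) * dw s" for s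
  obtain L where L: "0 \<le> L" "\<And>s. s \<in> {0..t} \<Longrightarrow> \<bar>w t - w s\<bar> \<le> L * (t - s)"
    using lipschitz_from_left[OF ld w t] by blast
  have w_lim: "(w \<longlongrightarrow> w s) (at s within {0..t})" if "s \<in> {0..t}" for s
    using continuous_on_subset[OF w, of "{0..t}"] that t unfolding continuous_on_def by auto
  have F_cont: "continuous_on {0..t} F"
    unfolding continuous_on_def
  proof
    fix s assume s: "s \<in> {0..t}"
    show "(F \<longlongrightarrow> F s) (at s within {0..t})"
    proof (cases "s = t")
      case False
      then show ?thesis unfolding F_def using w_lim[OF s] by (intro tendsto_intros) auto
    next
      case True
      have "((\<lambda>s. L * (t - s) powr (1 - \<alpha>)) \<longlongrightarrow> L * (t - t) powr (1 - \<alpha>)) (at t within {0..t})"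
        using \<alpha> by (intro tendsto_intros tendsto_powr') (auto simp: eventually_at_filter)
      then have "((\<lambda>s. L * (t - s) powr (1 - \<alpha>)) \<longlongrightarrow> 0) (at t within {0..t})"
        by simp
      moreover have "\<forall>\<^sub>F s in at t within {0..t}. norm (F s) \<le> L * (t - s) powr (1 - \<alpha>)"
      proof -
        have "norm (F s) \<le> L * (t - s) powr (1 - \<alpha>)" if "s \<in> {0..t}" "s \<noteq> t" for s
        proof -
          have "norm (F s) \<le> (t - s) powr (- \<alpha>) * (L * (t - s))"
            unfolding F_def using L(2)[of s] that by (auto simp: abs_mult intro!: mult_left_mono)
          also have "\<dots> = L * (t - s) powr (1 - \<alpha>)"
            using that powr_add[of "t - s" "- \<alpha>" 1] by (simp add: add.commute)
          finally show ?thesis .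
        qed
        then show ?thesis by (auto simp: eventually_at_filter)
      qed
      ultimately have "(F \<longlongrightarrow> 0) (at t within {0..t})"
        by (rule Lim_null_comparison[rotated])
      then show ?thesis using True by (simp add: F_def)
    qed
  qed
  define S where "S = {s\<in>{0<..<T}. \<not> isCont dw s}"
  have S: "finite S" using ld unfolding left_continuous_derivative_def S_def by auto
  have F_deriv: "(F has_vector_derivative f s) (at s)" if s: "s \<in> {0<..<t} - S" for s
  proof -
    have dws: "(w has_real_derivative dw s) (at s)"
      by (rule derivative_at_continuity_point[OF ld w]) (use s t in \<open>auto simp: S_def\<close>)
    have "((\<lambda>s. t - s) has_real_derivative - 1) (at s)"
      by (auto intro!: derivative_eq_intros)
    from DERIV_chain2[OF has_real_derivative_powr this, of "- \<alpha>"]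
    have "((\<lambda>s. (t - s) powr (- \<alpha>)) has_real_derivative
        (- \<alpha>) * (t - s) powr (- \<alpha> - 1) * (- 1)) (at s)"
      using s by simp
    then have "(F has_real_derivative f s) (at s)"
      unfolding F_def[abs_def] f_def by (rule DERIV_cong[OF DERIV_mult]) (auto intro!: derivative_eq_intros dws)
    then show ?thesis by (simp add: has_real_derivative_iff_has_vector_derivative)
  qed
  have "(f has_integral F t - F 0) {0..t}"
    by (rule fundamental_theorem_of_calculus_interior_strong[OF S _ F_deriv F_cont]) (use t in auto)
  then have "(f has_integral - (t powr (- \<alpha>) * (w t - w 0))) {0<..<t}"
    by (simp add: F_def has_integral_Icc_iff_Ioo)
  moreover
  note R = reformulated_integrand_integrable[OF ld w t \<alpha>]
  have "set_integrable lborel {0<..<t} f"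
    unfolding f_def using R int by (rule set_integral_diff(1))
  ultimately have "(LBINT s:{0<..<t}. f s) = - (t powr (- \<alpha>) * (w t - w 0))"
    by (simp add: set_borel_integral_eq_integral(2) integral_unique)
  moreover have "(LBINT s:{0<..<t}. f s) =
      (LBINT s:{0<..<t}. \<alpha> * (t - s) powr (- \<alpha> - 1) * (w t - w s)) -
      (LBINT s:{0<..<t}. (t - s) powr (- \<alpha>) * dw s)"
    unfolding f_def using R int by (rule set_integral_diff(2))
  ultimately show ?thesis
    unfolding caputo_classical_def caputo_reformulated_def by simp
qed

text \<open>
  Two solutions may fall into different branches of the definition of the fractional derivative.
  Comparing them is possible because the reformulation covers both branches.
\<close>

lemma frac_deriv_eq_reformulated:
  assumes "left_continuous_derivative T w dw" "continuous_on {0..T} w"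
    and "0 < t" "t \<le> T" "0 < \<alpha>" "\<alpha> < 1"
  shows "frac_deriv \<alpha> w dw t = caputo_reformulated \<alpha> w t"
  unfolding frac_deriv_def using caputo_classical_eq_reformulated[OF assms] assms by auto

text \<open>
  In the reformulation the value at \<open>t\<close> is compared with earlier values under nonnegative weights, so
  the inequality between \<open>w\<close> and \<open>u\<close> passes to the fractional derivatives at any \<open>t\<close> where \<open>w - u\<close>
  is at least as large as before.
\<close>

lemma caputo_mono_at_max:
  assumes w: "left_continuous_derivative T w dw" "continuous_on {0..T} w"
    and u: "left_continuous_derivative T u du" "continuous_on {0..T} u"
    and t: "0 < t" "t \<le> T" and \<alpha>: "0 < \<alpha>" "\<alpha> < 1"
    and max: "\<And>s. s \<in> {0..t} \<Longrightarrow> w s - u s \<le> w t - u t"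
  shows "caputo_reformulated \<alpha> u t \<le> caputo_reformulated \<alpha> w t"
proof -
  have "(LBINT s:{0<..<t}. \<alpha> * (t - s) powr (- \<alpha> - 1) * (u t - u s))
      \<le> (LBINT s:{0<..<t}. \<alpha> * (t - s) powr (- \<alpha> - 1) * (w t - w s))"
  proof (rule set_integral_mono)
    fix s assume "s \<in> {0<..<t}"
    then have "u t - u s \<le> w t - w s" using max[of s] by simp
    then show "\<alpha> * (t - s) powr (- \<alpha> - 1) * (u t - u s) \<le> \<alpha> * (t - s) powr (- \<alpha> - 1) * (w t - w s)"
      using \<alpha> by (intro mult_left_mono) auto
  qed (intro reformulated_integrand_integrable[OF u t \<alpha>] reformulated_integrand_integrable[OF w t \<alpha>])+
  moreover have "t powr (- \<alpha>) * (u t - u 0) \<le> t powr (- \<alpha>) * (w t - w 0)"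
    using max[of 0] t by (intro mult_left_mono) auto
  moreover have "0 < Gamma (1 - \<alpha>)"
    using \<alpha> by (intro Gamma_real_pos) auto
  ultimately show ?thesis
    unfolding caputo_reformulated_def by (intro mult_left_mono) auto
qed

lemma derivative_ge_at_max:
  assumes w: "left_continuous_derivative T w dw" "continuous_on {0..T} w"
    and u: "left_continuous_derivative T u du" "continuous_on {0..T} u"
    and t: "0 < t" "t \<le> T"
    and max: "\<And>s. s \<in> {0..t} \<Longrightarrow> w s - u s - m * s \<le> w t - u t - m * t"
  shows "m \<le> dw t - du t"
proof (rule field_le_epsilon)
  fix e :: real assume "0 < e"
  then have e: "0 < e / 2" by simp
  obtain \<delta> where \<delta>: "0 < \<delta>" "\<delta> \<le> t"
    "\<And>s. t - \<delta> < s \<Longrightarrow> s \<le> t \<Longrightarrow> \<bar>w t - w s - dw t * (t - s)\<bar> \<le> e / 2 * (t - s)"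
    using derivative_from_left[OF w t e] by blast
  obtain \<eta> where \<eta>: "0 < \<eta>" "\<eta> \<le> t"
    "\<And>s. t - \<eta> < s \<Longrightarrow> s \<le> t \<Longrightarrow> \<bar>u t - u s - du t * (t - s)\<bar> \<le> e / 2 * (t - s)"
    using derivative_from_left[OF u t e] by blast
  define h where "h = min \<delta> \<eta> / 2"
  have h: "0 < h" "h < \<delta>" "h < \<eta>" using \<delta> \<eta> by (auto simp: h_def)
  have "\<bar>w t - w (t - h) - dw t * h\<bar> \<le> e / 2 * h" "\<bar>u t - u (t - h) - du t * h\<bar> \<le> e / 2 * h"
    using \<delta>(3)[of "t - h"] \<eta>(3)[of "t - h"] h by auto
  moreover have "m * h \<le> (w t - w (t - h)) - (u t - u (t - h))"
    using max[of "t - h"] h \<delta> by (simp add: algebra_simps)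
  moreover have "(dw t - du t + e) * h = dw t * h - du t * h + 2 * (e / 2 * h)"
    by (simp add: algebra_simps)
  ultimately have "m * h \<le> (dw t - du t + e) * h"
    by linarith
  then show "m \<le> dw t - du t + e" using h by simp
qed

text \<open>
  A comparison argument at a maximum \<open>x\<close> of \<open>w - u - m s\<close> with \<open>m > 0\<close>. If that maximum were
  positive, it would lie at \<open>x > 0\<close>, where every fractional term and the zeroth order term of \<open>w\<close>
  would be at least that of \<open>u\<close>. The slope \<open>m\<close> makes the first order term strictly larger, because
  \<open>q 1 x > 0\<close>; without it, the terms at \<open>x\<close> could all agree and there would be no contradiction.
  Hence \<open>w - u \<le> m t\<close> for every \<open>m > 0\<close>.
\<close>

lemma solution_le:
  fixes q :: "nat \<Rightarrow> real \<Rightarrow> real"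
  assumes "0 < T" "1 \<le> l"
    and \<alpha>1: "\<alpha> 1 = 1" and \<alpha>: "\<And>i. i \<in> {2..l} \<Longrightarrow> 0 < \<alpha> i \<and> \<alpha> i < 1"
    and q: "\<And>i t. i \<in> {2..l} \<Longrightarrow> t \<in> {0..T} \<Longrightarrow> 0 \<le> q i t"
    and q1: "\<And>t. t \<in> {0..T} \<Longrightarrow> 0 < q 1 t" and lam: "0 \<le> lam"
    and sol_w: "is_solution T l \<alpha> q lam v w0 w" and sol_u: "is_solution T l \<alpha> q lam v w0 u"
    and t: "t \<in> {0..T}"
  shows "w t \<le> u t"
proof -
  have w: "continuous_on {0..T} w" "w 0 = w0" and u: "continuous_on {0..T} u" "u 0 = w0"
    using sol_w sol_u unfolding is_solution_def by auto
  obtain dw where dw: "left_continuous_derivative T w dw"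
      "\<And>t. t \<in> {0<..T} \<Longrightarrow> (\<Sum>i=1..l. q i t * frac_deriv (\<alpha> i) w dw t) + lam * w t = v t"
    using sol_w unfolding is_solution_def by auto
  obtain du where du: "left_continuous_derivative T u du"
      "\<And>t. t \<in> {0<..T} \<Longrightarrow> (\<Sum>i=1..l. q i t * frac_deriv (\<alpha> i) u du t) + lam * u t = v t"
    using sol_u unfolding is_solution_def by auto
  have bound: "w t - u t \<le> m * t" if m: "0 < m" for m
  proof -
    define z where "z s = w s - u s - m * s" for s
    have "continuous_on {0..T} z"
      unfolding z_def by (intro continuous_intros w u)
    then obtain x where x: "x \<in> {0..T}" "\<And>s. s \<in> {0..T} \<Longrightarrow> z s \<le> z x"
      using continuous_attains_sup[of "{0..T}" z] \<open>0 < T\<close> by auto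
    have "z x \<le> 0"
    proof (rule ccontr)
      assume pos: "\<not> z x \<le> 0"
      moreover have "z 0 = 0" using w u by (simp add: z_def)
      ultimately have "x \<noteq> 0" by auto
      then have x0: "0 < x" "x \<le> T" using x by auto
      have "m * s \<le> m * x" if "s \<le> x" for s using m that by simp
      then have diff_max: "w s - u s \<le> w x - u x" if "s \<in> {0..x}" for s
        using x(2)[of s] that x0 unfolding z_def by fastforce
      have "m \<le> dw x - du x"
        by (rule derivative_ge_at_max[OF dw(1) w(1) du(1) u(1) x0])
           (use x x0 in \<open>auto simp: z_def\<close>)
      then have first: "q 1 x * du x < q 1 x * dw x"
        using q1[OF x(1)] m by simp
      have rest: "(\<Sum>i=2..l. q i x * frac_deriv (\<alpha> i) u du x) \<le> (\<Sum>i=2..l. q i x * frac_deriv (\<alpha> i) w dw x)"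
      proof (rule sum_mono)
        fix i assume i: "i \<in> {2..l}"
        then have "caputo_reformulated (\<alpha> i) u x \<le> caputo_reformulated (\<alpha> i) w x"
          using caputo_mono_at_max[OF dw(1) w(1) du(1) u(1) x0 _ _ diff_max] \<alpha> by auto
        then show "q i x * frac_deriv (\<alpha> i) u du x \<le> q i x * frac_deriv (\<alpha> i) w dw x"
          using frac_deriv_eq_reformulated[OF dw(1) w(1) x0] frac_deriv_eq_reformulated[OF du(1) u(1) x0]
            \<alpha>[OF i] q[OF i x(1)] by (auto intro!: mult_left_mono)
      qed
      have "0 \<le> m * x" using m x0 by simp
      then have "u x \<le> w x" using pos unfolding z_def by linarith
      then have zeroth: "lam * u x \<le> lam * w x" using lam by (rule mult_left_mono)
      have split: "(\<Sum>i=1..l. f i) = f 1 + (\<Sum>i=2..l. f i)" for f :: "nat \<Rightarrow> real"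
        using sum.atLeast_Suc_atMost[OF \<open>1 \<le> l\<close>, of f] by (simp add: numeral_2_eq_2)
      have "q 1 x * dw x + (\<Sum>i=2..l. q i x * frac_deriv (\<alpha> i) w dw x) + lam * w x = v x"
        using dw(2)[of x] x0 \<alpha>1 unfolding split by (simp add: frac_deriv_def)
      moreover have "q 1 x * du x + (\<Sum>i=2..l. q i x * frac_deriv (\<alpha> i) u du x) + lam * u x = v x"
        using du(2)[of x] x0 \<alpha>1 unfolding split by (simp add: frac_deriv_def)
      ultimately show False using first rest zeroth by linarith
    qed
    then show ?thesis using x(2)[OF t] by (simp add: z_def)
  qed
  have "w t - u t \<le> 0"
  proof (rule field_le_epsilon)
    fix e :: real assume "0 < e"
    then have "w t - u t \<le> e / T * t" using bound[of "e / T"] \<open>0 < T\<close> by simp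
    also have "\<dots> \<le> e / T * T" using t \<open>0 < e\<close> \<open>0 < T\<close> by (intro mult_left_mono) auto
    finally show "w t - u t \<le> 0 + e" using \<open>0 < T\<close> by simp
  qed
  then show ?thesis by simp
qed

section \<open>Existence of a continuously differentiable solution\<close>

lemma continuous_imp_Linf:
  assumes "continuous_on {l..u} f"
  shows "f \<in> Linf l u"
proof -
  have "continuous_on {l<..<u} f"
    by (rule continuous_on_subset[OF assms]) auto
  from borel_measurable_continuous_on_indicator[OF borel_open[OF open_greaterThanLessThan] this]
  have "set_borel_measurable lborel {l<..<u} f"
    by (simp add: set_borel_measurable_def)
  moreover have "bounded (f ` {l..u})"
    by (intro compact_imp_bounded compact_continuous_image assms compact_Icc)
  then obtain M where "\<And>x. x \<in> {l..u} \<Longrightarrow> \<bar>f x\<bar> \<le> M"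
    unfolding bounded_iff by (metis imageI real_norm_def)
  then have "AE x in lborel. x \<in> {l<..<u} \<longrightarrow> \<bar>f x\<bar> \<le> M"
    by (intro AE_I2) auto
  ultimately show ?thesis unfolding Linf_def by blast
qed

text \<open>
  Integration by parts; the boundary terms vanish since a test function is 0 at both end points.
\<close>

lemma classical_derivative_is_weak:
  assumes lu: "l \<le> u" and w: "\<And>x. x \<in> {l..u} \<Longrightarrow> (w has_real_derivative g x) (at x within {l..u})"
    and g: "continuous_on {l..u} g"
  shows "weak_derivative l u w g"
  unfolding weak_derivative_def locally_integrable_def
proof (intro conjI allI impI)
  have w_cont: "continuous_on {l..u} w"
    using w by (rule DERIV_continuous_on)
  show "set_integrable lborel {c..d} w" if "l < c \<and> d < u" for c d
    by (rule borel_integrable_atLeastAtMost', rule continuous_on_subset[OF w_cont]) (use that in auto)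
  show "set_integrable lborel {c..d} g" if "l < c \<and> d < u" for c d
    by (rule borel_integrable_atLeastAtMost', rule continuous_on_subset[OF g]) (use that in auto)
  fix \<phi> assume \<phi>: "test_function l u \<phi>"
  then obtain \<phi>' where "\<And>x. (\<phi> has_vector_derivative \<phi>' x) (at x)" and \<phi>': "continuous_on UNIV \<phi>'"
    unfolding test_function_def C1_differentiable_on_def by auto
  then have der: "(\<phi> has_real_derivative \<phi>' x) (at x)" for x
    by (simp add: has_real_derivative_iff_has_vector_derivative)
  then have deriv: "deriv \<phi> = \<phi>'"
    by (auto intro: DERIV_imp_deriv)
  have \<phi>_cont: "continuous_on {l..u} \<phi>"
    by (rule DERIV_continuous_on) (rule has_field_derivative_at_within[OF der])
  obtain c d where "l < c" "d < u" "\<And>x. x \<notin> {c..d} \<Longrightarrow> \<phi> x = 0"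
    using \<phi> unfolding test_function_def by auto
  then have zero: "\<phi> l = 0" "\<phi> u = 0" by auto
  have "((\<lambda>x. w x * \<phi>' x + g x * \<phi> x) has_integral w u * \<phi> u - w l * \<phi> l) {l..u}"
  proof (rule fundamental_theorem_of_calculus[OF lu])
    fix x assume x: "x \<in> {l..u}"
    have "((\<lambda>x. w x * \<phi> x) has_real_derivative g x * \<phi> x + \<phi>' x * w x) (at x within {l..u})"
      by (rule DERIV_mult[OF w[OF x] has_field_derivative_at_within[OF der]])
    then show "((\<lambda>x. w x * \<phi> x) has_vector_derivative w x * \<phi>' x + g x * \<phi> x) (at x within {l..u})"
      by (simp add: has_real_derivative_iff_has_vector_derivative algebra_simps)
  qed
  then have zero_int: "((\<lambda>x. w x * \<phi>' x + g x * \<phi> x) has_integral 0) {l<..<u}"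
    by (simp add: zero has_integral_Icc_iff_Ioo)
  have int: "set_integrable lborel {l<..<u} f" if "continuous_on {l..u} f" for f :: "real \<Rightarrow> real"
    by (rule set_integrable_subset[OF borel_integrable_atLeastAtMost'[OF that]]) auto
  have i1: "set_integrable lborel {l<..<u} (\<lambda>x. w x * \<phi>' x)"
    by (intro int continuous_intros w_cont continuous_on_subset[OF \<phi>']) auto
  have i2: "set_integrable lborel {l<..<u} (\<lambda>x. g x * \<phi> x)"
    by (intro int continuous_intros g \<phi>_cont)
  have "(LBINT x:{l<..<u}. w x * \<phi>' x) + (LBINT x:{l<..<u}. g x * \<phi> x)
      = (LBINT x:{l<..<u}. w x * \<phi>' x + g x * \<phi> x)"
    by (rule set_integral_add(2)[OF i1 i2, symmetric])
  also have "\<dots> = 0"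
    using set_borel_integral_eq_integral(2)[OF set_integral_add(1)[OF i1 i2]] zero_int
    by (simp add: integral_unique)
  finally show "(LBINT x:{l<..<u}. w x * deriv \<phi> x) = - (LBINT x:{l<..<u}. g x * \<phi> x)"
    by (simp add: deriv)
qed

text \<open>
  In terms of \<open>g = w'\<close> every term of the equation is a convolution of \<open>g\<close> with a power of exponent
  greater than \<open>- 1\<close>: the fractional derivatives by definition, and \<open>w = w0 + \<integral> g\<close> as the case of
  exponent 0. Dividing by \<open>q 1\<close> gives a Volterra equation of the second kind.
\<close>

lemma C1_solution_exists:
  fixes q :: "nat \<Rightarrow> real \<Rightarrow> real"
  assumes T: "0 < T" and l: "1 \<le> l"
    and \<alpha>1: "\<alpha> 1 = 1" and \<alpha>: "\<And>i. i \<in> {2..l} \<Longrightarrow> 0 < \<alpha> i \<and> \<alpha> i < 1"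
    and q: "\<And>i. i \<in> {1..l} \<Longrightarrow> continuous_on {0..T} (q i)"
    and q1: "\<And>t. t \<in> {0..T} \<Longrightarrow> 0 < q 1 t"
    and v: "continuous_on {0..T} v"
  shows "\<exists>w. is_solution T l \<alpha> q lam v w0 w \<and> w \<in> C1_on_interval 0 T"
proof -
  \<comment> \<open>Index 1 belongs to \<open>lam * w\<close>: the first order derivative itself is the unknown.\<close>
  define k where "k i r = r powr (- (if i = 1 then 0 else \<alpha> i))" for i and r :: real
  define c where "c i t = - (if i = 1 then lam else q i t / Gamma (1 - \<alpha> i)) / q 1 t" for i t
  have q1_nz: "q 1 t \<noteq> 0" if "t \<in> {0..T}" for t using q1[OF that] by simp
  have "\<exists>g. continuous_on UNIV g \<and> (\<exists>B. \<forall>t. \<bar>g t\<bar> \<le> B) \<and>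
           (\<forall>t\<in>{0..T}. g t = (v t - lam * w0) / q 1 t
              + (\<Sum>i\<in>{1..l}. c i t * (LBINT r:{0<..<t}. k i r * g (t - r))))"
  proof (rule volterra_convolution_exists)
    fix i assume i: "i \<in> {1..l}"
    show "set_integrable lborel {0<..<T} (k i)"
      unfolding k_def by (rule powr_kernel_integrable) (use \<alpha>[of i] i in auto)
    show "continuous_on {0..T} (c i)"
      unfolding c_def divide_inverse using q[OF i] q[of 1] l q1_nz
      by (cases "i = 1") (auto intro!: continuous_intros)
  next
    show "continuous_on {0..T} (\<lambda>t. (v t - lam * w0) / q 1 t)"
      using v q[of 1] l q1_nz by (auto intro!: continuous_intros)
  qed (use T in auto)
  then obtain g B where g: "continuous_on UNIV g" and B: "\<And>t. \<bar>g t\<bar> \<le> B"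
    and eq: "\<And>t. t \<in> {0..T} \<Longrightarrow> g t = (v t - lam * w0) / q 1 t
              + (\<Sum>i\<in>{1..l}. c i t * (LBINT r:{0<..<t}. k i r * g (t - r)))"
    by blast
  define w where "w t = w0 + integral {0..t} g" for t
  have g_on: "continuous_on A g" for A by (rule continuous_on_subset[OF g]) auto
  have w_deriv: "(w has_real_derivative g t) (at t within {0..T})" if "t \<in> {0..T}" for t
    unfolding w_def
    using DERIV_add[OF DERIV_const[of w0] integral_has_real_derivative[OF g_on that]] by simp
  have w_sub: "(w has_real_derivative g t) (at t within {a..b})" if "t \<in> {a..b}" "0 \<le> a" "b \<le> T" for t a b
    by (rule DERIV_subset[OF w_deriv]) (use that in auto)
  have w_cont: "continuous_on {0..T} w"
    using w_deriv by (rule DERIV_continuous_on)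
  have wd: "weak_derivative \<epsilon> t w g" if "0 < \<epsilon>" "\<epsilon> < t" "t \<le> T" for \<epsilon> t
    by (rule classical_derivative_is_weak) (use that g_on w_sub in auto)
  have W: "w \<in> W1inf \<epsilon> t" if "0 < \<epsilon>" "\<epsilon> < t" "t \<le> T" for \<epsilon> t
  proof -
    have "continuous_on {\<epsilon>..t} w"
      by (rule continuous_on_subset[OF w_cont]) (use that in auto)
    then show ?thesis
      unfolding W1inf_def using wd[OF that] continuous_imp_Linf g_on by blast
  qed
  have g_at: "isCont g t" for t using g by (simp add: continuous_on_eq_continuous_at)
  have ld: "left_continuous_derivative T w g"
    unfolding left_continuous_derivative_def
  proof (intro conjI allI ballI impI)
    show "continuous (at_left t) g" for t
      by (rule continuous_at_imp_continuous_at_within[OF g_at])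
    show "\<exists>r. (g \<longlongrightarrow> r) (at_right t)" for t
      using continuous_at_imp_continuous_at_within[OF g_at, of t "{t<..}"]
      unfolding continuous_within by blast
  qed (use wd g_at in auto)
  have "(\<Sum>i=1..l. q i t * frac_deriv (\<alpha> i) w g t) + lam * w t = v t" if t: "t \<in> {0<..T}" for t
  proof -
    have tT: "t \<in> {0..T}" using t by auto
    define J where "J i = (LBINT r:{0<..<t}. k i r * g (t - r))" for i
    have split: "(\<Sum>i=1..l. f i) = f 1 + (\<Sum>i=2..l. f i)" for f :: "nat \<Rightarrow> real"
      using sum.atLeast_Suc_atMost[OF l, of f] by (simp add: numeral_2_eq_2)
    have "J 1 = (LBINT r:{0<..<t}. g (t - r))"
      unfolding J_def by (rule set_lebesgue_integral_cong) (auto simp: k_def)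
    also have "\<dots> = (LBINT s:{0<..<t}. g s)"
      by (rule reflect_interval_integral(1)[symmetric])
    also have "\<dots> = integral {0<..<t} g"
      by (rule set_borel_integral_eq_integral(2),
          rule set_integrable_subset[OF borel_integrable_atLeastAtMost'[OF g_on, of 0 t]]) auto
    finally have J1: "w t = w0 + J 1"
      by (simp add: w_def integral_open_interval_real)
    have J: "frac_deriv (\<alpha> i) w g t = J i / Gamma (1 - \<alpha> i)" if i: "i \<in> {2..l}" for i
    proof -
      have k_i: "k i = (\<lambda>r. r powr (- \<alpha> i))" using i by (auto simp: k_def)
      have "set_integrable lborel {0<..<t} (\<lambda>r. r powr (- \<alpha> i) * g (t - r))"
        using convolution_integrable[OF powr_kernel_integrable g B] \<alpha>[OF i] by blast
      then have "set_integrable lborel {0<..<t} (\<lambda>s. (t - s) powr (- \<alpha> i) * g s)"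
        by (subst (asm) reflect_interval_integral(2)) simp
      moreover have "J i = (LBINT s:{0<..<t}. (t - s) powr (- \<alpha> i) * g s)"
        unfolding J_def k_i by (subst reflect_interval_integral(1)) simp
      ultimately show ?thesis
        using \<alpha>[OF i] unfolding frac_deriv_def caputo_classical_def by simp
    qed
    have "g t = (v t - lam * w0) / q 1 t + (\<Sum>i=1..l. c i t * J i)"
      using eq[OF tT] by (simp only: J_def)
    then have "q 1 t * g t = q 1 t * ((v t - lam * w0) / q 1 t) + q 1 t * (\<Sum>i=1..l. c i t * J i)"
      by (simp only: distrib_left)
    also have "q 1 t * ((v t - lam * w0) / q 1 t) = v t - lam * w0"
      using q1_nz[OF tT] by simp
    also have "q 1 t * (\<Sum>i=1..l. c i t * J i) = (\<Sum>i=1..l. q 1 t * (c i t * J i))"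
      by (rule sum_distrib_left)
    also have "\<dots> = q 1 t * (c 1 t * J 1) + (\<Sum>i=2..l. q 1 t * (c i t * J i))"
      by (rule split)
    also have "q 1 t * (c 1 t * J 1) = - (lam * J 1)"
      using q1_nz[OF tT] by (simp add: c_def)
    also have "(\<Sum>i=2..l. q 1 t * (c i t * J i)) = - (\<Sum>i=2..l. q i t * frac_deriv (\<alpha> i) w g t)"
      unfolding sum_negf[symmetric]
    proof (rule sum.cong)
      fix i assume i: "i \<in> {2..l}"
      then have "c i t = - (q i t / Gamma (1 - \<alpha> i)) / q 1 t"
        by (auto simp: c_def)
      then show "q 1 t * (c i t * J i) = - (q i t * frac_deriv (\<alpha> i) w g t)"
        using q1_nz[OF tT] J[OF i] by simp
    qed simp
    also have "v t - lam * w0 + (- (lam * J 1) + - (\<Sum>i=2..l. q i t * frac_deriv (\<alpha> i) w g t))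
        = v t - lam * w t - (\<Sum>i=2..l. q i t * frac_deriv (\<alpha> i) w g t)"
      unfolding J1 distrib_left by linarith
    finally have "q 1 t * g t = v t - lam * w t - (\<Sum>i=2..l. q i t * frac_deriv (\<alpha> i) w g t)" .
    moreover have "frac_deriv (\<alpha> 1) w g t = g t" unfolding frac_deriv_def \<alpha>1 by simp
    ultimately show ?thesis unfolding split by simp
  qed
  moreover have "w 0 = w0" by (simp add: w_def)
  ultimately have "is_solution T l \<alpha> q lam v w0 w"
    unfolding is_solution_def using w_cont W ld by blast
  moreover have "w \<in> C1_on_interval 0 T"
    unfolding C1_on_interval_def using w_deriv g_on by blast
  ultimately show ?thesis by blast
qed

theorem lemma2p11:
  fixes T lam w0 :: real and l :: nat
    and \<alpha> :: "nat \<Rightarrow> real" and q :: "nat \<Rightarrow> real \<Rightarrow> real" and v :: "real \<Rightarrow> real"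
  assumes "T > 0" and "l \<ge> 1"
    and "\<forall>i\<in>{1..l}. 0 < \<alpha> i"
    and "\<forall>i\<in>{1..l}. \<forall>j\<in>{1..l}. i < j \<longrightarrow> \<alpha> j < \<alpha> i"
    and "\<alpha> 1 = 1"
    and "\<forall>i\<in>{1..l}. \<forall>t\<in>{0..T}. q i t \<ge> 0"
    and "\<forall>t\<in>{0..T}. q 1 t > 0"
    and "continuous_on {0..T} v"
    and "\<forall>i\<in>{1..l}. continuous_on {0..T} (q i)"
    and "lam \<ge> 0"
  shows "(\<exists>w. is_solution T l \<alpha> q lam v w0 w \<and> w \<in> C1_on_interval 0 T) \<and>
         (\<forall>w u. is_solution T l \<alpha> q lam v w0 w \<and> is_solution T l \<alpha> q lam v w0 u \<longrightarrow>
                (\<forall>t\<in>{0..T}. w t = u t))"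
proof (intro conjI allI impI ballI)
  have \<alpha>: "0 < \<alpha> i \<and> \<alpha> i < 1" if "i \<in> {2..l}" for i
  proof -
    have i: "i \<in> {1..l}" "1 \<in> {1..l}" "1 < i" using that by auto
    then have "\<alpha> i < \<alpha> 1" using assms(4) by blast
    then show ?thesis using assms(3,5) i(1) by simp
  qed
  show "\<exists>w. is_solution T l \<alpha> q lam v w0 w \<and> w \<in> C1_on_interval 0 T"
    by (rule C1_solution_exists[where \<alpha> = \<alpha>, OF assms(1,2,5) \<alpha>]) (use assms(7-9) in auto)
  fix w u t
  assume sols: "is_solution T l \<alpha> q lam v w0 w \<and> is_solution T l \<alpha> q lam v w0 u"
    and t: "t \<in> {0..T}"
  have le: "w t \<le> u t" if "is_solution T l \<alpha> q lam v w0 w" "is_solution T l \<alpha> q lam v w0 u" for w u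
    by (rule solution_le[where \<alpha> = \<alpha>, OF assms(1,2,5) \<alpha> _ _ assms(10) that t]) (use assms(6,7) in auto)
  show "w t = u t"
    using le sols by (intro antisym) auto
qed

end
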